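(* Let $d_0,d_2$ be positive integers and $r\in\mathbb{N}$. Identify elements of $(\mathrm{Sym}_r(\mathbb{R}^{d_0}))^{d_2}$ with $d_2$-tuples of order-$r$ symmetric tensors of format $d_0\times d_0\times\cdots\times d_0$. The neuromanifold $\mathcal{M}_{(d_0,1,d_2),r}$ consists of the $d_2$-tuples of order-$r$ symmetric tensors of format $d_0\times\cdots\times d_0$ of rank at most one such that all the rank-1 tensors are multiples of each other. The neuromanifold is equal to the neurovariety $\mathcal{V}_{(d_0,1,d_2),r}$, and the ideal of the neurovariety is generated by the $2\times2$ minors of the flattenings of the $d_0\times\cdots\times d_0\times d_0d_2$ tensor (of order $r$) that is obtained from combining the $d_2$ symmetric $d_0\times\cdots\times d_0$ tensors along the last index.
   Context: $\mathrm{Sym}_d(\mathbb{R}^n)$ denotes the real vector space of homogeneous polynomials of degree $d$ in $n$ variables. A polynomial neural network (PNN) with architecture $(\mathbf{d}=(d_0,\dots,d_L),r)$ is the map $p_{\mathbf{w}}=W_L\circ\rho_r\circ W_{L-1}\circ\cdots\circ\rho_r\circ W_1:\mathbb{R}^{d_0}\to\mathbb{R}^{d_L}$, where $W_i\in\mathbb{R}^{d_i\times d_{i-1}}$ are linear maps (weights) $\mathbf{w}=(W_1,\dots,W_L)$ and $\rho_r$ raises each coordinate to the $r$-th power. The parameter map is $\Psi_{\mathbf{d},r}:\mathbf{w}\mapsto p_{\mathbf{w}}\in(\mathrm{Sym}_{r^{L-1}}(\mathbb{R}^{d_0}))^{d_L}$. The neuromanifold $\mathcal{M}_{\mathbf{d},r}$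 is the image of $\Psi_{\mathbf{d},r}$; the neurovariety $\mathcal{V}_{\mathbf{d},r}$ is its Zariski closure in $(\mathrm{Sym}_{r^{L-1}}(\mathbb{R}^{d_0}))^{d_L}$. The ideal of the neurovariety is the ideal of all polynomials in the coefficient coordinates vanishing on it. A symmetric tensor $T=(T_{j_1\ldots j_r})\in\mathbb{R}^{d_0\times\cdots\times d_0}$ corresponds to the homogeneous polynomial $F(\mathbf{x})=\sum_{1\le j_1,\dots,j_r\le d_0}T_{j_1\cdots j_r}x_{j_1}\cdots x_{j_r}$; this is a bijection between order-$r$ symmetric tensors of format $d_0\times\cdots\times d_0$ and homogeneous polynomials of degree $r$ in $d_0$ variables. The symmetric rank of $T$ (over $\mathbb{R}$) is the smallest $k$ with $T=\sum_{i=1}^k\lambda_i v_i\otimes\cdots\otimes v_i$, $\lambda_i\in\mathbb{R}$, $v_i\in\mathbb{R}^{d_0}$. For a tensor $T\in\mathbb{R}^{n_1\times\cdots\times n_r}$, a partition $I_1\cup I_2=[r]$ induces a flattening of $T$ to a matrix in $\mathbb{R}^{D_1\times D_2}$, $D_j=\prod_{i\in I_j}n_i$, with rows indexed by the indices in $I_1$ and columns by the indices in $I_2$. Combining $T^{(1)},\dots,T^{(d_2)}$ along the last index means forming the $d_0\times\cdots\times d_0\times d_0d_2$ tensor whose entry at $(j_1,\dots,j_{r-1},(k-1)d_0+j_r)$ is $T^{(k)}_{j_1\cdots j_r}$.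
   Formalization: The claim on ideal generators excludes r = 1 with d_0, d_2 ≥ 2, where it is false: the neurovariety is the d_2×d_0 matrices of rank at most one, with nonzero ideal, while the combined order-1 tensor has flattenings without 2×2 minors. *)

theory Defs
  imports
    "HOL-Library.Poly_Mapping"
    "HOL-Library.Extended_Nat"
    "HOL-Library.Multiset"
    "HOL-Algebra.Ideal"
    "Jordan_Normal_Form.Matrix"
begin

subsection \<open>Multivariate polynomials over the reals\<close>

type_synonym 'v monomial = "'v \<Rightarrow>\<^sub>0 nat"
type_synonym 'v mpoly = "('v \<Rightarrow>\<^sub>0 nat) \<Rightarrow>\<^sub>0 real"

definition Const :: "real \<Rightarrow> 'v mpoly" where
  "Const c = Poly_Mapping.single 0 c"

definition Var :: "'v \<Rightarrow> 'v mpoly" where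
  "Var v = Poly_Mapping.single (Poly_Mapping.single v 1) 1"

definition eval_monomial :: "('v \<Rightarrow> real) \<Rightarrow> 'v monomial \<Rightarrow> real" where
  "eval_monomial x m = (\<Prod>v\<in>Poly_Mapping.keys m. x v ^ Poly_Mapping.lookup m v)"

definition eval :: "('v \<Rightarrow> real) \<Rightarrow> 'v mpoly \<Rightarrow> real" where
  "eval x p = (\<Sum>m\<in>Poly_Mapping.keys p. Poly_Mapping.lookup p m * eval_monomial x m)"

lemma eval_superset:
  assumes "finite S" "Poly_Mapping.keys p \<subseteq> S"
  shows "eval x p = (\<Sum>m\<in>S. Poly_Mapping.lookup p m * eval_monomial x m)"
  unfolding eval_def
  by (rule sum.mono_neutral_left) (use assms in \<open>auto simp: in_keys_iff\<close>)

lemma eval_monomial_superset: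
  assumes "finite S" "Poly_Mapping.keys m \<subseteq> S"
  shows "eval_monomial x m = (\<Prod>v\<in>S. x v ^ Poly_Mapping.lookup m v)"
  unfolding eval_monomial_def
  by (rule prod.mono_neutral_left) (use assms in \<open>auto simp: in_keys_iff\<close>)

lemma eval_monomial_0 [simp]: "eval_monomial x 0 = 1"
  by (simp add: eval_monomial_def)

lemma eval_monomial_single [simp]: "eval_monomial x (Poly_Mapping.single v k) = x v ^ k"
  by (cases "k = 0") (auto simp: eval_monomial_def)

lemma eval_monomial_add: "eval_monomial x (m + m') = eval_monomial x m * eval_monomial x m'"
proof -
  let ?S = "Poly_Mapping.keys m \<union> Poly_Mapping.keys m'"
  have "Poly_Mapping.keys (m + m') \<subseteq> ?S"
    by (rule keys_add)
  then show ?thesis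
    by (simp add: eval_monomial_superset[of ?S] lookup_add power_add prod.distrib)
qed

lemma eval_0 [simp]: "eval x 0 = 0"
  by (simp add: eval_def)

lemma eval_single [simp]: "eval x (Poly_Mapping.single m c) = c * eval_monomial x m"
  by (cases "c = 0") (auto simp: eval_def)

lemma eval_1 [simp]: "eval x 1 = 1"
  by (simp flip: single_one)

lemma eval_Const [simp]: "eval x (Const c) = c"
  by (simp add: Const_def)

lemma eval_Var [simp]: "eval x (Var v) = x v"
  by (simp add: Var_def)

lemma eval_add: "eval x (p + q) = eval x p + eval x q"
proof -
  let ?S = "Poly_Mapping.keys p \<union> Poly_Mapping.keys q"
  have "Poly_Mapping.keys (p + q) \<subseteq> ?S"
    by (rule keys_add)
  then show ?thesis
    by (simp add: eval_superset[of ?S] lookup_add distrib_right sum.distrib)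
qed

lemma eval_sum: "eval x (sum f A) = (\<Sum>a\<in>A. eval x (f a))"
  by (induction A rule: infinite_finite_induct) (auto simp: eval_add)

lemma mpoly_as_sum:
  "p = (\<Sum>m\<in>Poly_Mapping.keys p. Poly_Mapping.single m (Poly_Mapping.lookup p m))"
proof (rule poly_mapping_eqI)
  fix k
  show "Poly_Mapping.lookup p k = Poly_Mapping.lookup
    (\<Sum>m\<in>Poly_Mapping.keys p. Poly_Mapping.single m (Poly_Mapping.lookup p m)) k"
    by (simp add: lookup_sum lookup_single when_def in_keys_iff sum.delta)
qed

lemma eval_mult: "eval x (p * q) = eval x p * eval x q"
proof -
  let ?s = "\<lambda>p m. Poly_Mapping.single m (Poly_Mapping.lookup p m)"
  have "p * q = (\<Sum>m\<in>Poly_Mapping.keys p. ?s p m) * (\<Sum>m\<in>Poly_Mapping.keys q. ?s q m)"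
    by (simp flip: mpoly_as_sum)
  also have "\<dots> = (\<Sum>m\<in>Poly_Mapping.keys p. \<Sum>m'\<in>Poly_Mapping.keys q. ?s p m * ?s q m')"
    by (rule sum_product)
  finally have "eval x (p * q)
      = (\<Sum>m\<in>Poly_Mapping.keys p. \<Sum>m'\<in>Poly_Mapping.keys q. eval x (?s p m) * eval x (?s q m'))"
    by (simp add: eval_sum mult_single eval_monomial_add mult_ac)
  also have "\<dots> = eval x p * eval x q"
    by (simp add: sum_product[symmetric]) (simp add: eval_def)
  finally show ?thesis .
qed

lemma eval_power: "eval x (p ^ k) = eval x p ^ k"
  by (induction k) (auto simp: eval_mult)

interpretation eval_hom: semiring_hom "eval x"
  by unfold_locales (auto simp: eval_add eval_mult)


subsection \<open>Homogeneous polynomials and their coefficient coordinates\<close>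

text \<open>Indices are 0-based throughout: \<open>monomials n e\<close> are the monomials of degree \<open>e\<close> in the
  variables \<open>0, \<dots>, n - 1\<close>, and \<open>hom_tuples n e m\<close> is the space of \<open>m\<close>-tuples of
  forms of degree \<open>e\<close> in \<open>n\<close> variables.\<close>

definition monomials :: "nat \<Rightarrow> nat \<Rightarrow> nat monomial set" where
  "monomials n e = {\<mu>. Poly_Mapping.keys \<mu> \<subseteq> {..<n} \<and> (\<Sum>i<n. Poly_Mapping.lookup \<mu> i) = e}"

definition hom_polys :: "nat \<Rightarrow> nat \<Rightarrow> nat mpoly set" where
  "hom_polys n e = {F. Poly_Mapping.keys F \<subseteq> monomials n e}"

definition hom_tuples :: "nat \<Rightarrow> nat \<Rightarrow> nat \<Rightarrow> nat mpoly vec set" where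
  "hom_tuples n e m = {F \<in> carrier_vec m. \<forall>k<m. F $ k \<in> hom_polys n e}"

text \<open>The coordinate \<open>(k, \<mu>)\<close> of a tuple is the coefficient of \<open>\<mu>\<close> in its \<open>k\<close>-th entry.\<close>

definition coords :: "nat \<Rightarrow> nat \<Rightarrow> nat \<Rightarrow> (nat \<times> nat monomial) set" where
  "coords n e m = {..<m} \<times> monomials n e"

definition coord_ring :: "nat \<Rightarrow> nat \<Rightarrow> nat \<Rightarrow> (nat \<times> nat monomial) mpoly ring" where
  "coord_ring n e m =
    \<lparr>carrier = {p. \<forall>\<mu>\<in>Poly_Mapping.keys p. Poly_Mapping.keys \<mu> \<subseteq> coords n e m},
     monoid.mult = (*), one = 1, zero = 0, add = (+)\<rparr>"

definition coord_eval :: "nat mpoly vec \<Rightarrow> (nat \<times> nat monomial) mpoly \<Rightarrow> real" where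
  "coord_eval F p = eval (\<lambda>(k, \<mu>). Poly_Mapping.lookup (F $ k) \<mu>) p"

definition zero_locus ::
  "nat \<Rightarrow> nat \<Rightarrow> nat \<Rightarrow> (nat \<times> nat monomial) mpoly set \<Rightarrow> nat mpoly vec set" where
  "zero_locus n e m P = {F \<in> hom_tuples n e m. \<forall>p\<in>P. coord_eval F p = 0}"

definition zariski_closed :: "nat \<Rightarrow> nat \<Rightarrow> nat \<Rightarrow> nat mpoly vec set \<Rightarrow> bool" where
  "zariski_closed n e m A \<longleftrightarrow> (\<exists>P \<subseteq> carrier (coord_ring n e m). A = zero_locus n e m P)"

definition vanishing_ideal ::
  "nat \<Rightarrow> nat \<Rightarrow> nat \<Rightarrow> nat mpoly vec set \<Rightarrow> (nat \<times> nat monomial) mpoly set" where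
  "vanishing_ideal n e m A = {p \<in> carrier (coord_ring n e m). \<forall>F\<in>A. coord_eval F p = 0}"

lemma coord_ring_mult_closed:
  assumes "p \<in> carrier (coord_ring n e m)" "q \<in> carrier (coord_ring n e m)"
  shows "p * q \<in> carrier (coord_ring n e m)"
proof -
  have "Poly_Mapping.keys \<mu> \<subseteq> coords n e m" if \<mu>: "\<mu> \<in> Poly_Mapping.keys (p * q)" for \<mu>
  proof -
    obtain a b where "\<mu> = a + b" "a \<in> Poly_Mapping.keys p" "b \<in> Poly_Mapping.keys q"
      using \<mu> keys_mult[of p q] by blast
    with assms keys_add[of a b] show ?thesis
      unfolding coord_ring_def by fastforce
  qed
  then show ?thesis
    by (simp add: coord_ring_def)
qed

lemma coord_ring_add_closed:
  assumes "p \<in> carrier (coord_ring n e m)" "q \<in> carrier (coord_ring n e m)"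
  shows "p + q \<in> carrier (coord_ring n e m)"
  using assms keys_add[of p q] unfolding coord_ring_def by fastforce

lemma coord_ring_simps [simp]:
  "x \<oplus>\<^bsub>coord_ring n e m\<^esub> y = x + y"
  "x \<otimes>\<^bsub>coord_ring n e m\<^esub> y = x * y"
  "\<zero>\<^bsub>coord_ring n e m\<^esub> = 0"
  "\<one>\<^bsub>coord_ring n e m\<^esub> = 1"
  "0 \<in> carrier (coord_ring n e m)"
  "1 \<in> carrier (coord_ring n e m)"
  by (simp_all add: coord_ring_def flip: single_one)

lemma cring_coord_ring: "cring (coord_ring n e m)"
proof (rule cringI)
  show "abelian_group (coord_ring n e m)"
  proof (rule abelian_groupI)
    fix p assume "p \<in> carrier (coord_ring n e m)"
    then have "- p \<in> carrier (coord_ring n e m)"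
      by (simp add: coord_ring_def)
    then show "\<exists>q\<in>carrier (coord_ring n e m). q \<oplus>\<^bsub>coord_ring n e m\<^esub> p = \<zero>\<^bsub>coord_ring n e m\<^esub>"
      by (intro bexI[of _ "- p"]) simp_all
  qed (simp_all add: coord_ring_add_closed add.assoc add.commute)
  show "comm_monoid (coord_ring n e m)"
    by (rule comm_monoidI) (simp_all add: coord_ring_mult_closed mult.assoc mult.commute)
qed (simp add: distrib_right)


subsection \<open>Polynomial neural networks\<close>

text \<open>The network is defined over an arbitrary commutative semiring so that the same equations give
  both the map \<open>p\<^sub>w\<close> on real vectors and, evaluated at the vector of indeterminates, the
  corresponding tuple of polynomials. No activation follows the last weight matrix.\<close>

fun pnn :: "nat \<Rightarrow> 'a::comm_semiring_1 mat list \<Rightarrow> 'a vec \<Rightarrow> 'a vec" where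
  "pnn r [] x = x"
| "pnn r [W] x = W *\<^sub>v x"
| "pnn r (W # W' # Ws) x = pnn r (W' # Ws) (map_vec (\<lambda>t. t ^ r) (W *\<^sub>v x))"

definition weights :: "nat list \<Rightarrow> real mat list set" where
  "weights d = {Ws. length Ws = length d - 1 \<and>
     (\<forall>i<length Ws. Ws ! i \<in> carrier_mat (d ! (i + 1)) (d ! i))}"

definition param_map :: "nat list \<Rightarrow> nat \<Rightarrow> real mat list \<Rightarrow> nat mpoly vec" where
  "param_map d r Ws = pnn r (map (map_mat Const) Ws) (vec (hd d) Var)"

definition neuromanifold :: "nat list \<Rightarrow> nat \<Rightarrow> nat mpoly vec set" where
  "neuromanifold d r = param_map d r ` weights d"

definition neurovariety :: "nat list \<Rightarrow> nat \<Rightarrow> nat mpoly vec set" where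
  "neurovariety d r =
     zariski_closed (hd d) (r ^ (length d - 2)) (last d) hull neuromanifold d r"

lemma weights_Cons:
  assumes "W # Ws \<in> weights (a # b # d)"
  shows "W \<in> carrier_mat b a" "Ws \<in> weights (b # d)"
proof -
  have len: "length Ws = length d"
    and *: "\<And>i. i < length (W # Ws) \<Longrightarrow>
      (W # Ws) ! i \<in> carrier_mat ((a # b # d) ! (i + 1)) ((a # b # d) ! i)"
    using assms by (simp_all add: weights_def)
  show "W \<in> carrier_mat b a"
    using *[of 0] by simp
  have "Ws ! i \<in> carrier_mat ((b # d) ! (i + 1)) ((b # d) ! i)" if "i < length Ws" for i
    using *[of "i + 1"] that by simp
  with len show "Ws \<in> weights (b # d)"
    by (simp add: weights_def)
qed

lemma weights_ConsE:
  assumes "W # Ws \<in> weights d"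
  obtains a b d' where "d = a # b # d'" "W \<in> carrier_mat b a" "Ws \<in> weights (b # d')"
proof -
  from assms have "2 \<le> length d"
    by (auto simp: weights_def)
  then obtain a b d' where d: "d = a # b # d'"
    by (cases d; cases "tl d") auto
  show thesis
    by (rule that[OF d]) (use assms weights_Cons[of W Ws a b d'] d in simp_all)
qed

lemma eval_pnn:
  fixes X :: "'v mpoly vec"
  assumes "Ws \<in> weights d" "X \<in> carrier_vec (hd d)"
  shows "map_vec (eval x) (pnn r (map (map_mat Const) Ws) X) = pnn r Ws (map_vec (eval x) X)"
  using assms
proof (induction r Ws "map_vec (eval x) X" arbitrary: d X rule: pnn.induct)
  case (1 r)
  then show ?case by simp
next
  case (2 r W)
  obtain a b d' where d: "d = a # b # d'" and W: "W \<in> carrier_mat b a"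
    using 2(1) by (rule weights_ConsE)
  have X: "X \<in> carrier_vec a"
    using 2 d by simp
  have "map_vec (eval x) (map_mat Const W *\<^sub>v X)
      = map_mat (eval x) (map_mat Const W) *\<^sub>v map_vec (eval x) X"
    using eval_hom.mult_mat_vec_hom W X by (metis map_carrier_mat)
  moreover have "map_mat (eval x) (map_mat Const W) = W"
    by (rule eq_matI) auto
  ultimately show ?case
    by simp
next
  case (3 r W W' Ws)
  obtain a b d' where d: "d = a # b # d'" and W: "W \<in> carrier_mat b a"
    and Ws: "W' # Ws \<in> weights (b # d')"
    using 3(2) by (rule weights_ConsE)
  have X: "X \<in> carrier_vec a"
    using 3 d by simp
  define Y where "Y = map_mat Const W *\<^sub>v X"
  have Y: "Y \<in> carrier_vec b"
    using W X unfolding Y_def by (metis map_carrier_mat mult_mat_vec_carrier)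
  have "map_vec (eval x) Y = map_mat (eval x) (map_mat Const W) *\<^sub>v map_vec (eval x) X"
    unfolding Y_def using eval_hom.mult_mat_vec_hom W X by (metis map_carrier_mat)
  moreover have "map_mat (eval x) (map_mat Const W) = W"
    by (rule eq_matI) auto
  ultimately have evY: "map_vec (eval x) Y = W *\<^sub>v map_vec (eval x) X"
    by simp
  have pow: "map_vec (eval x) (map_vec (\<lambda>t. t ^ r) Y)
      = map_vec (\<lambda>t. t ^ r) (W *\<^sub>v map_vec (eval x) X)"
    unfolding evY[symmetric] by (rule eq_vecI) (auto simp: eval_power)
  have "map_vec (eval x) (pnn r (map (map_mat Const) (W' # Ws)) (map_vec (\<lambda>t. t ^ r) Y))
      = pnn r (W' # Ws) (map_vec (eval x) (map_vec (\<lambda>t. t ^ r) Y))"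
    by (rule 3(1)[OF _ Ws]) (use pow Y in auto)
  then show ?case
    by (simp add: evY pow flip: Y_def)
qed

lemma eval_param_map:
  assumes "Ws \<in> weights d" "x \<in> carrier_vec (hd d)"
  shows "map_vec (eval (($) x)) (param_map d r Ws) = pnn r Ws x"
proof -
  have "map_vec (eval (($) x)) (vec (hd d) Var) = x"
    using assms(2) by (intro eq_vecI) auto
  then show ?thesis
    unfolding param_map_def using eval_pnn[OF assms(1), of "vec (hd d) Var" "($) x" r] by simp
qed

lemma monomials_0: "0 \<in> monomials n 0"
  by (simp add: monomials_def)

lemma monomials_add:
  assumes "\<mu> \<in> monomials n e" "\<nu> \<in> monomials n f"
  shows "\<mu> + \<nu> \<in> monomials n (e + f)"
  using assms keys_add[of \<mu> \<nu>] unfolding monomials_def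
  by (auto simp: lookup_add sum.distrib)

lemma hom_polys_0: "0 \<in> hom_polys n e"
  by (simp add: hom_polys_def)

lemma hom_polys_Const: "Const c \<in> hom_polys n 0"
  by (simp add: hom_polys_def Const_def monomials_0)

lemma hom_polys_Var: "i < n \<Longrightarrow> Var i \<in> hom_polys n 1"
  by (simp add: hom_polys_def Var_def monomials_def lookup_single when_def sum.delta)

lemma hom_polys_add:
  assumes "F \<in> hom_polys n e" "G \<in> hom_polys n e"
  shows "F + G \<in> hom_polys n e"
  using assms keys_add[of F G] unfolding hom_polys_def by auto

lemma hom_polys_sum: "(\<And>a. a \<in> A \<Longrightarrow> f a \<in> hom_polys n e) \<Longrightarrow> sum f A \<in> hom_polys n e"
  by (induction A rule: infinite_finite_induct) (auto simp: hom_polys_0 hom_polys_add)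

lemma hom_polys_mult:
  assumes "F \<in> hom_polys n e" "G \<in> hom_polys n f"
  shows "F * G \<in> hom_polys n (e + f)"
  using assms keys_mult[of F G] monomials_add unfolding hom_polys_def by blast

lemma hom_polys_power: "F \<in> hom_polys n e \<Longrightarrow> F ^ k \<in> hom_polys n (e * k)"
proof (induction k)
  case 0
  show ?case
    using hom_polys_Const[of 1 n] by (simp add: Const_def)
next
  case (Suc k)
  then show ?case
    using hom_polys_mult[of F n e "F ^ k" "e * k"] by simp
qed

lemma hom_tuples_mult_mat:
  assumes W: "W \<in> carrier_mat b a" and X: "X \<in> hom_tuples n e a"
  shows "map_mat Const W *\<^sub>v X \<in> hom_tuples n e b"
proof -
  have "(map_mat Const W *\<^sub>v X) $ i \<in> hom_polys n e" if i: "i < b" for i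
  proof -
    have "(map_mat Const W *\<^sub>v X) $ i = (\<Sum>j<a. Const (W $$ (i, j)) * X $ j)"
      using i W X by (auto simp: hom_tuples_def scalar_prod_def lessThan_atLeast0)
    moreover have "Const (W $$ (i, j)) * X $ j \<in> hom_polys n e" if "j < a" for j
      using hom_polys_mult[OF hom_polys_Const, of "X $ j" n e] X that
      by (auto simp: hom_tuples_def)
    ultimately show ?thesis
      by (auto intro: hom_polys_sum)
  qed
  then show ?thesis
    using W by (auto simp: hom_tuples_def intro!: carrier_vecI)
qed

lemma hom_tuples_pnn:
  fixes X :: "nat mpoly vec"
  assumes "Ws \<in> weights d" "Ws \<noteq> []" "X \<in> hom_tuples n e (hd d)"
  shows "pnn r (map (map_mat Const) Ws) X \<in> hom_tuples n (e * r ^ (length d - 2)) (last d)"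
  using assms
proof (induction Ws arbitrary: d e X)
  case Nil
  then show ?case by simp
next
  case (Cons W Ws)
  obtain a b d' where d: "d = a # b # d'" and W: "W \<in> carrier_mat b a"
    and Ws: "Ws \<in> weights (b # d')"
    using Cons.prems(1) by (rule weights_ConsE)
  have WX: "map_mat Const W *\<^sub>v X \<in> hom_tuples n e b"
    using hom_tuples_mult_mat W Cons.prems(3) d by simp
  show ?case
  proof (cases Ws)
    case Nil
    with Ws have "d' = []"
      by (auto simp: weights_def)
    then show ?thesis
      using Nil d WX by simp
  next
    case (Cons W' Ws')
    with Ws have len: "length d' \<ge> 1"
      by (auto simp: weights_def)
    have "map_vec (\<lambda>t. t ^ r) (map_mat Const W *\<^sub>v X) \<in> hom_tuples n (e * r) b"
      using W WX hom_polys_power by (auto simp: hom_tuples_def)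
    then have "pnn r (map (map_mat Const) Ws) (map_vec (\<lambda>t. t ^ r) (map_mat Const W *\<^sub>v X))
        \<in> hom_tuples n (e * r * r ^ (length (b # d') - 2)) (last (b # d'))"
      using Cons.IH[OF Ws] Cons by simp
    moreover have "e * r * r ^ (length (b # d') - 2) = e * r ^ (length d - 2)"
      using len d by (cases d') (auto simp: mult_ac)
    moreover have "last (b # d') = last d"
      using d by simp
    ultimately have "pnn r (map (map_mat Const) Ws) (map_vec (\<lambda>t. t ^ r) (map_mat Const W *\<^sub>v X))
        \<in> hom_tuples n (e * r ^ (length d - 2)) (last d)"
      by (simp only:)
    then show ?thesis
      using Cons by simp
  qed
qed

lemma neuromanifold_subset_hom_tuples:
  assumes "length d \<ge> 2"
  shows "neuromanifold d r \<subseteq> hom_tuples (hd d) (r ^ (length d - 2)) (last d)"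
proof -
  have "vec (hd d) Var \<in> hom_tuples (hd d) 1 (hd d)"
    using hom_polys_Var by (simp add: hom_tuples_def)
  then have "param_map d r Ws \<in> hom_tuples (hd d) (r ^ (length d - 2)) (last d)"
    if "Ws \<in> weights d" for Ws
    using hom_tuples_pnn[of Ws d "vec (hd d) Var" "hd d" 1 r] that assms
    by (fastforce simp: param_map_def weights_def)
  then show ?thesis
    by (auto simp: neuromanifold_def)
qed


subsection \<open>Tensors\<close>

text \<open>A tensor of format \<open>ns = [n\<^sub>1, \<dots>, n\<^sub>r]\<close> is a function on the lists
  \<open>[j\<^sub>1, \<dots>, j\<^sub>r]\<close> with \<open>j\<^sub>i < n\<^sub>i\<close>.\<close>

definition tensor_indices :: "nat list \<Rightarrow> nat list set" where
  "tensor_indices ns = {J. length J = length ns \<and> (\<forall>i<length ns. J ! i < ns ! i)}"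

definition sym_tensors :: "nat \<Rightarrow> nat \<Rightarrow> (nat list \<Rightarrow> real) set" where
  "sym_tensors n r = {T \<in> extensional (tensor_indices (replicate r n)).
     \<forall>J\<in>tensor_indices (replicate r n). \<forall>J'. mset J' = mset J \<longrightarrow> T J' = T J}"

definition index_monomial :: "nat list \<Rightarrow> nat monomial" where
  "index_monomial J = (\<Sum>j\<leftarrow>J. Poly_Mapping.single j 1)"

definition tensor_poly :: "nat \<Rightarrow> nat \<Rightarrow> (nat list \<Rightarrow> real) \<Rightarrow> nat mpoly" where
  "tensor_poly n r T =
     (\<Sum>J\<in>tensor_indices (replicate r n). Poly_Mapping.single (index_monomial J) (T J))"

text \<open>The rank is \<open>\<infinity>\<close> if there is no decomposition at all.\<close>

definition sym_rank :: "nat \<Rightarrow> nat \<Rightarrow> (nat list \<Rightarrow> real) \<Rightarrow> enat" where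
  "sym_rank n r T = Inf (enat ` {k. \<exists>(c :: nat \<Rightarrow> real) (v :: nat \<Rightarrow> nat \<Rightarrow> real).
     \<forall>J\<in>tensor_indices (replicate r n). T J = (\<Sum>i<k. c i * (\<Prod>j\<leftarrow>J. v i j))})"

text \<open>Row indices of the flattening along \<open>I\<^sub>1\<close>, \<open>I\<^sub>2\<close> are the functions
  choosing an index for each position in \<open>I\<^sub>1\<close>, column indices likewise for \<open>I\<^sub>2\<close>.\<close>

definition flattening ::
  "nat list \<Rightarrow> nat set \<Rightarrow> (nat list \<Rightarrow> 'a) \<Rightarrow> (nat \<Rightarrow> nat) \<Rightarrow> (nat \<Rightarrow> nat) \<Rightarrow> 'a" where
  "flattening ns I\<^sub>1 T a b = T (map (\<lambda>i. if i \<in> I\<^sub>1 then a i else b i) [0..<length ns])"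

definition minor2 :: "('i \<Rightarrow> 'j \<Rightarrow> 'a::comm_ring_1) \<Rightarrow> 'i \<Rightarrow> 'i \<Rightarrow> 'j \<Rightarrow> 'j \<Rightarrow> 'a" where
  "minor2 M a a' b b' = M a b * M a' b' - M a b' * M a' b"

definition flattening_minors :: "nat list \<Rightarrow> (nat list \<Rightarrow> 'a::comm_ring_1) \<Rightarrow> 'a set" where
  "flattening_minors ns T =
    {minor2 (flattening ns I\<^sub>1 T) a a' b b' | I\<^sub>1 I\<^sub>2 a a' b b'.
       I\<^sub>1 \<union> I\<^sub>2 = {..<length ns} \<and> I\<^sub>1 \<inter> I\<^sub>2 = {} \<and>
       a \<in> (\<Pi>\<^sub>E i\<in>I\<^sub>1. {..<ns ! i}) \<and> a' \<in> (\<Pi>\<^sub>E i\<in>I\<^sub>1. {..<ns ! i}) \<and> a \<noteq> a' \<and>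
       b \<in> (\<Pi>\<^sub>E i\<in>I\<^sub>2. {..<ns ! i}) \<and> b' \<in> (\<Pi>\<^sub>E i\<in>I\<^sub>2. {..<ns ! i}) \<and> b \<noteq> b'}"

text \<open>With 0-based indices, the last index \<open>k * n + j\<close> of the combined tensor stands for the
  last index \<open>j\<close> of \<open>T\<^sub>k\<close>. For \<open>r \<le> 1\<close> the format has length one, so there are
  no 2x2 minors; for \<open>r = 0\<close> (no last index to combine along) the format is a dummy.\<close>

definition combine :: "nat \<Rightarrow> (nat \<Rightarrow> nat list \<Rightarrow> 'a) \<Rightarrow> nat list \<Rightarrow> 'a" where
  "combine n T J = T (last J div n) (butlast J @ [last J mod n])"

definition combined_format :: "nat \<Rightarrow> nat \<Rightarrow> nat \<Rightarrow> nat list" where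
  "combined_format n r m = replicate (r - 1) n @ [n * m]"

text \<open>The entry \<open>J\<close> of the \<open>k\<close>-th symmetric tensor as a linear form in the coefficient
  coordinates: the coefficient of a monomial in \<open>tensor_poly n r T\<close> is the sum of the (equal)
  entries of \<open>T\<close> over all index lists giving that monomial; see \<open>coord_eval_tensor_entry\<close> below.\<close>

definition tensor_entry :: "nat \<Rightarrow> nat \<Rightarrow> nat \<Rightarrow> nat list \<Rightarrow> (nat \<times> nat monomial) mpoly" where
  "tensor_entry n r k J =
     Const (1 / real (card {J' \<in> tensor_indices (replicate r n). index_monomial J' = index_monomial J}))
       * Var (k, index_monomial J)"

lemma lookup_index_monomial: "Poly_Mapping.lookup (index_monomial J) j = count (mset J) j"
  by (induction J) (auto simp: index_monomial_def lookup_add lookup_single when_def)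

lemma index_monomial_eq_iff: "index_monomial J = index_monomial J' \<longleftrightarrow> mset J = mset J'"
  by (metis lookup_index_monomial multiset_eqI poly_mapping_eqI)

lemma tensor_indices_replicate:
  "J \<in> tensor_indices (replicate r n) \<longleftrightarrow> length J = r \<and> set J \<subseteq> {..<n}"
  by (auto simp: tensor_indices_def in_set_conv_nth subset_iff)

lemma finite_tensor_indices_replicate: "finite (tensor_indices (replicate r n))"
proof -
  have "tensor_indices (replicate r n) = {J. set J \<subseteq> {..<n} \<and> length J = r}"
    by (auto simp: tensor_indices_replicate)
  then show ?thesis
    using finite_lists_length_eq[of "{..<n}" r] by simp
qed

lemma tensor_indices_mset:
  "mset J' = mset J \<Longrightarrow> J \<in> tensor_indices (replicate r n) \<Longrightarrow> J' \<in> tensor_indices (replicate r n)"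
  by (metis mset_eq_length mset_eq_setD tensor_indices_replicate)

lemma index_monomial_in_monomials:
  assumes "J \<in> tensor_indices (replicate r n)"
  shows "index_monomial J \<in> monomials n r"
proof -
  have sub: "set J \<subseteq> {..<n}" and len: "length J = r"
    using assms by (auto simp: tensor_indices_replicate)
  have "(\<Sum>i<n. count (mset J) i) = (\<Sum>i\<in>set J. count (mset J) i)"
    by (rule sum.mono_neutral_right) (use sub in \<open>auto simp: count_eq_zero_iff\<close>)
  also have "\<dots> = size (mset J)"
    by (simp add: size_multiset_overloaded_eq)
  finally have "(\<Sum>i<n. count (mset J) i) = r"
    using len by simp
  moreover have "Poly_Mapping.keys (index_monomial J) = set J"
    by (auto simp: in_keys_iff lookup_index_monomial count_eq_zero_iff)
  ultimately show ?thesis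
    using sub by (simp add: monomials_def lookup_index_monomial)
qed

lemma ex_index_monomial:
  assumes "\<mu> \<in> monomials n r"
  obtains J where "J \<in> tensor_indices (replicate r n)" "index_monomial J = \<mu>"
proof -
  let ?M = "Abs_multiset (Poly_Mapping.lookup \<mu>)"
  have cnt: "count ?M = Poly_Mapping.lookup \<mu>"
    using finite_lookup[of \<mu>] by (intro count_Abs_multiset) simp
  obtain J where J: "mset J = ?M"
    using ex_mset by blast
  have mon: "index_monomial J = \<mu>"
    by (rule poly_mapping_eqI) (simp add: lookup_index_monomial J cnt)
  have set: "set J = Poly_Mapping.keys \<mu>"
    unfolding mon[symmetric] by (auto simp: in_keys_iff lookup_index_monomial count_eq_zero_iff)
  then have sub: "set J \<subseteq> {..<n}"
    using assms by (simp add: monomials_def)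
  have "length J = size (mset J)"
    by simp
  also have "\<dots> = (\<Sum>i\<in>set J. count (mset J) i)"
    by (simp add: size_multiset_overloaded_eq)
  also have "\<dots> = (\<Sum>i<n. count (mset J) i)"
    by (rule sum.mono_neutral_left) (use sub in \<open>auto simp: count_eq_zero_iff\<close>)
  also have "\<dots> = r"
    using assms by (simp add: monomials_def J cnt)
  finally show thesis
    using that mon sub by (simp add: tensor_indices_replicate)
qed

lemma lookup_tensor_poly:
  assumes T: "T \<in> sym_tensors n r" and J: "J \<in> tensor_indices (replicate r n)"
  shows "Poly_Mapping.lookup (tensor_poly n r T) (index_monomial J) =
    real (card {J' \<in> tensor_indices (replicate r n). index_monomial J' = index_monomial J}) * T J"
proof -
  let ?I = "tensor_indices (replicate r n)"
  let ?C = "{J' \<in> ?I. index_monomial J' = index_monomial J}"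
  have "Poly_Mapping.lookup (tensor_poly n r T) (index_monomial J) =
      (\<Sum>J'\<in>?I. if index_monomial J' = index_monomial J then T J' else 0)"
    by (simp add: tensor_poly_def lookup_sum lookup_single when_def)
  also have "\<dots> = (\<Sum>J'\<in>?C. T J')"
    using finite_tensor_indices_replicate by (simp add: sum.inter_filter)
  also have "\<dots> = (\<Sum>J'\<in>?C. T J)"
  proof (rule sum.cong)
    fix J' assume "J' \<in> ?C"
    then have "mset J' = mset J"
      by (simp add: index_monomial_eq_iff)
    then show "T J' = T J"
      using T J unfolding sym_tensors_def by blast
  qed simp
  finally show ?thesis
    by simp
qed

lemma index_class_card_pos:
  assumes "J \<in> tensor_indices (replicate r n)"
  shows "card {J' \<in> tensor_indices (replicate r n). index_monomial J' = index_monomial J} > 0"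
  using assms finite_tensor_indices_replicate[of r n] by (subst card_gt_0_iff) auto

lemma coord_eval_tensor_entry:
  assumes "\<And>k. k < m \<Longrightarrow> T k \<in> sym_tensors n r" "k < m" "J \<in> tensor_indices (replicate r n)"
  shows "coord_eval (vec m (\<lambda>k. tensor_poly n r (T k))) (tensor_entry n r k J) = T k J"
  using assms index_class_card_pos[OF assms(3)]
  by (simp add: coord_eval_def tensor_entry_def eval_mult lookup_tensor_poly)

lemma tensor_poly_in_hom_polys: "tensor_poly n r T \<in> hom_polys n r"
  unfolding tensor_poly_def
  by (rule hom_polys_sum) (simp add: hom_polys_def index_monomial_in_monomials)

lemma bij_betw_tensor_poly: "bij_betw (tensor_poly n r) (sym_tensors n r) (hom_polys n r)"
proof -
  let ?I = "tensor_indices (replicate r n)"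
  let ?c = "\<lambda>J. real (card {J' \<in> ?I. index_monomial J' = index_monomial J})"
  have inj: "inj_on (tensor_poly n r) (sym_tensors n r)"
  proof (rule inj_onI)
    fix S T assume ST: "S \<in> sym_tensors n r" "T \<in> sym_tensors n r"
      and eq: "tensor_poly n r S = tensor_poly n r T"
    show "S = T"
    proof (rule extensionalityI[of _ ?I])
      fix J assume J: "J \<in> ?I"
      then show "S J = T J"
        using lookup_tensor_poly[OF ST(1) J] lookup_tensor_poly[OF ST(2) J] eq
          index_class_card_pos[OF J] by simp
    qed (use ST in \<open>auto simp: sym_tensors_def\<close>)
  qed
  moreover have "F \<in> tensor_poly n r ` sym_tensors n r" if F: "F \<in> hom_polys n r" for F
  proof -
    define T where "T = (\<lambda>J\<in>?I. Poly_Mapping.lookup F (index_monomial J) / ?c J)"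
    have T: "T \<in> sym_tensors n r"
      unfolding sym_tensors_def
    proof (intro CollectI conjI ballI allI impI)
      show "T \<in> extensional ?I"
        by (simp add: T_def)
      fix J J' assume J: "J \<in> ?I" and eq: "mset J' = mset J"
      then have "J' \<in> ?I" "index_monomial J' = index_monomial J"
        using tensor_indices_mset index_monomial_eq_iff by blast+
      with J show "T J' = T J"
        by (simp add: T_def)
    qed
    have "Poly_Mapping.lookup (tensor_poly n r T) \<mu> = Poly_Mapping.lookup F \<mu>" for \<mu>
    proof (cases "\<mu> \<in> monomials n r")
      case True
      then obtain J where J: "J \<in> ?I" "index_monomial J = \<mu>"
        by (rule ex_index_monomial)
      show ?thesis
        using lookup_tensor_poly[OF T J(1)] J index_class_card_pos[OF J(1)] by (simp add: T_def)
    next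
      case False
      then have "\<mu> \<notin> Poly_Mapping.keys (tensor_poly n r T)" "\<mu> \<notin> Poly_Mapping.keys F"
        using tensor_poly_in_hom_polys[of n r T] F by (auto simp: hom_polys_def)
      then show ?thesis
        by (simp add: in_keys_iff)
    qed
    then have "tensor_poly n r T = F"
      by (rule poly_mapping_eqI)
    with T show ?thesis
      by blast
  qed
  ultimately show ?thesis
    using tensor_poly_in_hom_polys by (auto simp: bij_betw_def)
qed

lemma combine_tensor_entry_in_carrier:
  assumes r: "r \<ge> 1" and J: "J \<in> tensor_indices (combined_format n r m)"
  shows "combine n (tensor_entry n r) J \<in> carrier (coord_ring n r m)"
proof -
  have len: "length J = r" and nth: "\<And>i. i < r \<Longrightarrow> J ! i < (replicate (r - 1) n @ [n * m]) ! i"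
    using r J by (auto simp: tensor_indices_def combined_format_def)
  have last: "last J < n * m"
    using nth[of "r - 1"] len r by (simp add: last_conv_nth nth_append flip: length_greater_0_conv)
  then have n: "n > 0"
    by (cases n) auto
  have "set (butlast J) \<subseteq> {..<n}"
  proof
    fix x assume "x \<in> set (butlast J)"
    then obtain i where "i < r - 1" "x = J ! i"
      using len by (auto simp: in_set_conv_nth nth_butlast)
    then show "x \<in> {..<n}"
      using nth[of i] by (simp add: nth_append)
  qed
  then have "butlast J @ [last J mod n] \<in> tensor_indices (replicate r n)"
    using len r n by (auto simp: tensor_indices_replicate)
  moreover have "last J div n < m"
    using last by (simp add: less_mult_imp_div_less mult.commute)
  ultimately have "(last J div n, index_monomial (butlast J @ [last J mod n])) \<in> coords n r m"
    by (simp add: coords_def index_monomial_in_monomials)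
  then show ?thesis
    unfolding combine_def tensor_entry_def
    by (intro coord_ring_mult_closed) (auto simp: coord_ring_def Const_def Var_def)
qed

lemma flattening_in_range:
  assumes "I\<^sub>1 \<union> I\<^sub>2 = {..<length ns}"
    and "a \<in> (\<Pi>\<^sub>E i\<in>I\<^sub>1. {..<ns ! i})" "b \<in> (\<Pi>\<^sub>E i\<in>I\<^sub>2. {..<ns ! i})"
  shows "map (\<lambda>i. if i \<in> I\<^sub>1 then a i else b i) [0..<length ns] \<in> tensor_indices ns"
  using assms unfolding tensor_indices_def by (auto simp: PiE_iff)

lemma flattening_minors_combined_subset:
  "flattening_minors (combined_format n r m) (combine n (tensor_entry n r))
     \<subseteq> carrier (coord_ring n r m)"
proof
  fix p assume "p \<in> flattening_minors (combined_format n r m) (combine n (tensor_entry n r))"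
  then obtain I1 I2 a a' b b' where
    p: "p = minor2 (flattening (combined_format n r m) I1 (combine n (tensor_entry n r))) a a' b b'"
    and I: "I1 \<union> I2 = {..<length (combined_format n r m)}" "I1 \<inter> I2 = {}"
    and ab: "a \<in> (\<Pi>\<^sub>E i\<in>I1. {..<combined_format n r m ! i})"
      "a' \<in> (\<Pi>\<^sub>E i\<in>I1. {..<combined_format n r m ! i})" "a \<noteq> a'"
      "b \<in> (\<Pi>\<^sub>E i\<in>I2. {..<combined_format n r m ! i})"
      "b' \<in> (\<Pi>\<^sub>E i\<in>I2. {..<combined_format n r m ! i})" "b \<noteq> b'"
    unfolding flattening_minors_def by (elim CollectE exE conjE) (rule that)
  have "r \<ge> 1"
  proof (rule ccontr)
    assume "\<not> r \<ge> 1"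
    then have "I1 \<union> I2 = {0}"
      using I(1) by (simp add: combined_format_def lessThan_Suc)
    then consider "I1 = {}" | "I2 = {}"
      using I(2) by (metis Un_singleton_iff inf.idem insert_not_empty)
    then show False
    proof cases
      case 1
      then show False
        using ab(1,2,3) unfolding 1 PiE_empty_domain by simp
    next
      case 2
      then show False
        using ab(4,5,6) unfolding 2 PiE_empty_domain by simp
    qed
  qed
  then have M: "flattening (combined_format n r m) I1 (combine n (tensor_entry n r)) x y
      \<in> carrier (coord_ring n r m)"
    if "x \<in> (\<Pi>\<^sub>E i\<in>I1. {..<combined_format n r m ! i})"
      "y \<in> (\<Pi>\<^sub>E i\<in>I2. {..<combined_format n r m ! i})" for x y
    unfolding flattening_def
    by (intro combine_tensor_entry_in_carrier flattening_in_range[OF I(1)] that)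
  have diff: "u - v \<in> carrier (coord_ring n r m)"
    if "u \<in> carrier (coord_ring n r m)" "v \<in> carrier (coord_ring n r m)" for u v
    using coord_ring_add_closed[OF that(1), of "- v"] that(2) by (simp add: coord_ring_def)
  show "p \<in> carrier (coord_ring n r m)"
    unfolding p minor2_def by (intro diff coord_ring_mult_closed M ab)
qed

end

theory Submission
  imports Defs
begin

text \<open>
  Up to a nonzero scalar, the coordinate \<open>(k, \<mu>)\<close> is the entry \<open>T\<^sub>k(J)\<close> for any \<open>J\<close> with
  monomial \<open>\<mu>\<close>, and a point of the neuromanifold has \<open>T\<^sub>k(J) = c\<^sub>k \<Prod>\<^sub>j v\<^sub>j\<close>. A product of entries thus
  takes the value of a character that depends only on the multiset of the \<open>k\<close> and on the union of
  the multisets \<open>J\<close>, its multidegree: the neurovariety is toric.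

  Closedness: if the toric binomials vanish at a tuple with a nonzero entry, then some diagonal entry
  \<open>A = T\<^sub>k\<^sub>0(i,\<dots>,i)\<close> is nonzero, and \<open>T\<^sub>k(J) A\<^sup>r = T\<^sub>k(i,\<dots>,i) \<Prod>\<^sub>j T\<^sub>k\<^sub>0(j,i,\<dots>,i)\<close> writes the tuple in the required
  form.

  Ideal: for \<open>r \<ge> 2\<close>, the minors of the flattenings separating the first index from the others allow
  the exchange of a single index between two factors. As the tensors are symmetric, such exchanges
  connect any two products of the same multidegree, so modulo the minors a polynomial is a combination
  of one product per multidegree; if it vanishes on the neuromanifold, its coefficients are zero,
  since distinct characters are linearly independent.
\<close>

subsection \<open>Linear independence of characters\<close>

text \<open>Artin's argument. Each \<open>\<chi> u\<close> is an eigenfunction of the substitution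
  \<open>g\<close> with eigenvalue \<open>\<alpha> u\<close>. Substituting \<open>g z\<close> for
  \<open>z\<close> in the relation and subtracting \<open>\<alpha> s0\<close> times the relation
  removes \<open>s0\<close> and multiplies the coefficient of \<open>t\<close> by the nonzero number
  \<open>\<alpha> t - \<alpha> s0\<close>.\<close>

lemma sum_characters_eq_0_imp:
  fixes \<chi> :: "'a \<Rightarrow> 'b \<Rightarrow> real"
  assumes "finite S"
    and "\<And>s t. s \<in> S \<Longrightarrow> t \<in> S \<Longrightarrow> s \<noteq> t \<Longrightarrow>
      \<exists>g \<alpha>. \<alpha> s \<noteq> \<alpha> t \<and> (\<forall>u\<in>S. \<forall>z. \<chi> u (g z) = \<alpha> u * \<chi> u z)"
    and "\<And>s. s \<in> S \<Longrightarrow> \<exists>z. \<chi> s z \<noteq> 0"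
    and "\<And>z. (\<Sum>s\<in>S. b s * \<chi> s z) = 0"
    and "s \<in> S"
  shows "b s = 0"
  using assms
proof (induction S arbitrary: b s rule: finite_induct)
  case empty
  then show ?case by simp
next
  case (insert s0 S)
  have S: "b t = 0" if t: "t \<in> S" for t
  proof -
    have "t \<noteq> s0"
      using t insert.hyps by blast
    with insert.prems(1)[OF insertI2[OF t] insertI1[of s0 S]]
    obtain g \<alpha> where \<alpha>: "\<alpha> t \<noteq> \<alpha> s0"
      and g: "\<And>u z. u \<in> insert s0 S \<Longrightarrow> \<chi> u (g z) = \<alpha> u * \<chi> u z"
      by blast
    have "(\<Sum>u\<in>S. b u * (\<alpha> u - \<alpha> s0) * \<chi> u z) = 0" for z
    proof -
      have "(\<Sum>u\<in>S. b u * (\<alpha> u - \<alpha> s0) * \<chi> u z)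
          = (\<Sum>u\<in>insert s0 S. b u * (\<alpha> u - \<alpha> s0) * \<chi> u z)"
        using insert.hyps by simp
      also have "\<dots> = (\<Sum>u\<in>insert s0 S. b u * \<chi> u (g z) - \<alpha> s0 * (b u * \<chi> u z))"
        by (rule sum.cong) (simp_all add: g algebra_simps)
      also have "\<dots> = 0"
        unfolding sum_subtractf sum_distrib_left[symmetric] insert.prems(3) by simp
      finally show ?thesis .
    qed
    moreover have "\<exists>g \<alpha>. \<alpha> s \<noteq> \<alpha> u \<and> (\<forall>u\<in>S. \<forall>z. \<chi> u (g z) = \<alpha> u * \<chi> u z)"
      if "s \<in> S" "u \<in> S" "s \<noteq> u" for s u
      using insert.prems(1)[OF insertI2[OF that(1)] insertI2[OF that(2)] that(3)]
      by blast
    ultimately have "b t * (\<alpha> t - \<alpha> s0) = 0"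
      by (intro insert.IH[of "\<lambda>u. b u * (\<alpha> u - \<alpha> s0)" t] insert.prems(2)[OF insertI2] t)
    with \<alpha> show ?thesis by simp
  qed
  from insert.prems(2)[OF insertI1] obtain z where "\<chi> s0 z \<noteq> 0"
    by blast
  moreover have "b s0 * \<chi> s0 z = 0"
    using insert.prems(3)[of z] insert.hyps S by simp
  ultimately show ?case
    using S insert.prems(4) by auto
qed

text \<open>A monomial function of the parameters: \<open>z\<close> is the pair of the output
  weights and the input weights, and the two multisets of \<open>t\<close> are its exponent
  vectors.\<close>

definition character :: "nat multiset \<times> nat multiset \<Rightarrow> (nat \<Rightarrow> real) \<times> (nat \<Rightarrow> real) \<Rightarrow> real" where
  "character t z = (\<Prod>k\<in>#fst t. fst z k) * (\<Prod>j\<in>#snd t. snd z j)"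

lemma prod_mset_fun_upd:
  fixes x :: "'a \<Rightarrow> 'b::comm_semiring_1"
  shows "(\<Prod>j\<in>#M. (x(i := c * x i)) j) = c ^ count M i * (\<Prod>j\<in>#M. x j)"
  by (induction M) (auto simp: mult_ac)

text \<open>Doubling a single variable multiplies every monomial by 2 to the power of its exponent
  there. This distinguishes two monomials as soon as they differ in that exponent.\<close>

lemma character_separating:
  assumes "s \<noteq> t"
  shows "\<exists>g \<alpha>. \<alpha> s \<noteq> \<alpha> t \<and> (\<forall>u\<in>S. \<forall>z. character u (g z) = \<alpha> u * character u z)"
proof -
  consider i where "count (fst s) i \<noteq> count (fst t) i"
    | i where "count (snd s) i \<noteq> count (snd t) i"
    using assms by (metis multiset_eqI prod_eqI)
  then show ?thesis
  proof cases
    case (1 i)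
    then show ?thesis
      by (intro exI[of _ "\<lambda>(c, x). (c(i := 2 * c i), x)"] exI[of _ "\<lambda>u. 2 ^ count (fst u) i"])
        (auto simp: character_def prod_mset_fun_upd)
  next
    case (2 i)
    then show ?thesis
      by (intro exI[of _ "\<lambda>(c, x). (c, x(i := 2 * x i))"] exI[of _ "\<lambda>u. 2 ^ count (snd u) i"])
        (auto simp: character_def prod_mset_fun_upd)
  qed
qed

lemma character_independent:
  assumes "finite S" "\<And>z. (\<Sum>t\<in>S. b t * character t z) = 0" "t \<in> S"
  shows "b t = 0"
proof -
  have "character s (\<lambda>_. 1, \<lambda>_. 1) \<noteq> 0" for s
    by (simp add: character_def)
  then have nz: "\<exists>z. character s z \<noteq> 0" for s
    by (rule exI)
  show ?thesis
    by (rule sum_characters_eq_0_imp[of S character b t, OF assms(1) character_separating nz assms(2,3)])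
qed

subsection \<open>Rank-one tuples\<close>

text \<open>This is \<open>c\<close> times the \<open>r\<close>-fold tensor power of
  \<open>v\<close>; the restriction to index lists makes it extensional, as membership in
  \<open>sym_tensors\<close> demands.\<close>

definition power_tensor :: "nat \<Rightarrow> nat \<Rightarrow> real \<Rightarrow> (nat \<Rightarrow> real) \<Rightarrow> nat list \<Rightarrow> real" where
  "power_tensor n r c v = (\<lambda>J\<in>tensor_indices (replicate r n). c * (\<Prod>j\<leftarrow>J. v j))"

lemma power_tensor_in_sym_tensors: "power_tensor n r c v \<in> sym_tensors n r"
  unfolding sym_tensors_def
proof (intro CollectI conjI ballI allI impI)
  fix J J' :: "nat list"
  assume J: "J \<in> tensor_indices (replicate r n)" and eq: "mset J' = mset J"
  have "prod_list (map v J') = prod_list (map v J)"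
    using eq by (metis mset_map prod_mset_prod_list)
  then show "power_tensor n r c v J' = power_tensor n r c v J"
    using J tensor_indices_mset[OF eq J] by (simp add: power_tensor_def)
qed (simp add: power_tensor_def)

lemma tensor_poly_cong:
  assumes "\<And>J. J \<in> tensor_indices (replicate r n) \<Longrightarrow> S J = T J"
  shows "tensor_poly n r S = tensor_poly n r T"
  unfolding tensor_poly_def by (rule sum.cong) (simp_all add: assms)

lemma tensor_indices_Suc:
  "tensor_indices (replicate (Suc r) n) =
     (\<lambda>(j, J). j # J) ` ({..<n} \<times> tensor_indices (replicate r n))"
proof (intro equalityI subsetI)
  fix J assume "J \<in> tensor_indices (replicate (Suc r) n)"
  then show "J \<in> (\<lambda>(j, J). j # J) ` ({..<n} \<times> tensor_indices (replicate r n))"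
    unfolding tensor_indices_replicate by (cases J) (auto simp: image_iff tensor_indices_replicate)
next
  fix J assume "J \<in> (\<lambda>(j, J). j # J) ` ({..<n} \<times> tensor_indices (replicate r n))"
  then show "J \<in> tensor_indices (replicate (Suc r) n)"
    unfolding tensor_indices_replicate by (auto simp: tensor_indices_replicate)
qed

text \<open>Multiplying out without collecting equal monomials yields one term per index list. This
  is the shape of \<open>tensor_poly\<close>, so multinomial coefficients never appear.\<close>

lemma linear_form_power:
  "(\<Sum>j<n. Const (v j) * Var j) ^ r =
     (\<Sum>J\<in>tensor_indices (replicate r n). Poly_Mapping.single (index_monomial J) (\<Prod>j\<leftarrow>J. v j))"
proof (induction r)
  case 0
  have "tensor_indices (replicate 0 n) = {[]}"
    by (auto simp: tensor_indices_def)
  then show ?case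
    by (simp add: index_monomial_def)
next
  case (Suc r)
  let ?I = "tensor_indices (replicate r n)"
  let ?s = "\<lambda>J. Poly_Mapping.single (index_monomial J) (\<Prod>j\<leftarrow>J. v j)"
  have inj: "inj_on (\<lambda>(j, J). j # J) ({..<n} \<times> ?I)"
    by (auto simp: inj_on_def)
  have "(\<Sum>j<n. Const (v j) * Var j) ^ Suc r = (\<Sum>j<n. \<Sum>J\<in>?I. Const (v j) * Var j * ?s J)"
    by (simp add: Suc.IH sum_product)
  also have "\<dots> = (\<Sum>(j, J)\<in>{..<n} \<times> ?I. ?s (j # J))"
    unfolding sum.cartesian_product
    by (rule sum.cong) (auto simp: Const_def Var_def mult_single index_monomial_def)
  also have "\<dots> = (\<Sum>J\<in>tensor_indices (replicate (Suc r) n). ?s J)"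
    unfolding tensor_indices_Suc sum.reindex[OF inj] by (rule sum.cong) auto
  finally show ?case .
qed

lemma tensor_poly_power_tensor:
  "tensor_poly n r (power_tensor n r c v) = Const c * (\<Sum>j<n. Const (v j) * Var j) ^ r"
  unfolding linear_form_power tensor_poly_def sum_distrib_left
  by (rule sum.cong) (auto simp: power_tensor_def Const_def mult_single)

definition power_tuple :: "nat \<Rightarrow> nat \<Rightarrow> nat \<Rightarrow> (nat \<Rightarrow> real) \<times> (nat \<Rightarrow> real) \<Rightarrow> nat mpoly vec" where
  "power_tuple n r m z = vec m (\<lambda>k. tensor_poly n r (power_tensor n r (fst z k) (snd z)))"

lemma param_map_two_layers:
  assumes W: "W1 \<in> carrier_mat 1 n" "W2 \<in> carrier_mat m 1"
  shows "param_map [n, 1, m] r [W1, W2] = power_tuple n r m (\<lambda>k. W2 $$ (k, 0), \<lambda>j. W1 $$ (0, j))"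
  using W
  by (intro eq_vecI)
    (auto simp: param_map_def power_tuple_def tensor_poly_power_tensor scalar_prod_def
      lessThan_atLeast0)

text \<open>Values of the two parameter functions outside the index ranges do not influence the
  tuple. Total functions can therefore replace the weight matrices, and characters may be evaluated
  at arbitrary parameters.\<close>

lemma neuromanifold_eq_range: "neuromanifold [n, 1, m] r = range (power_tuple n r m)"
proof (intro equalityI subsetI)
  fix F assume "F \<in> neuromanifold [n, 1, m] r"
  then obtain Ws where Ws: "Ws \<in> weights [n, 1, m]" "F = param_map [n, 1, m] r Ws"
    by (auto simp: neuromanifold_def)
  then have "length Ws = 2"
    by (auto simp: weights_def)
  then obtain W1 W2 where [simp]: "Ws = [W1, W2]"
    by (auto simp: length_Suc_conv numeral_2_eq_2)
  have "W1 \<in> carrier_mat 1 n" "W2 \<in> carrier_mat m 1"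
    using Ws(1) by (auto simp: weights_def nth_Cons split: nat.splits)
  then show "F \<in> range (power_tuple n r m)"
    using Ws(2) param_map_two_layers by auto
next
  fix F assume "F \<in> range (power_tuple n r m)"
  then obtain c v where F: "F = power_tuple n r m (c, v)"
    by auto
  define W1 where "W1 = mat 1 n (\<lambda>(_, j). v j)"
  define W2 where "W2 = mat m 1 (\<lambda>(k, _). c k)"
  have W: "W1 \<in> carrier_mat 1 n" "W2 \<in> carrier_mat m 1"
    by (auto simp: W1_def W2_def)
  have "power_tensor n r (W2 $$ (k, 0)) (\<lambda>j. W1 $$ (0, j)) = power_tensor n r (c k) v"
    if "k < m" for k
  proof -
    have "(\<Prod>j\<leftarrow>J. W1 $$ (0, j)) = (\<Prod>j\<leftarrow>J. v j)" if "J \<in> tensor_indices (replicate r n)" for J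
      using that
      by (intro arg_cong[where f = prod_list] map_cong)
        (auto simp: W1_def tensor_indices_replicate subset_iff)
    then show ?thesis
      using that by (auto simp: power_tensor_def W2_def fun_eq_iff)
  qed
  then have "param_map [n, 1, m] r [W1, W2] = F"
    unfolding param_map_two_layers[OF W] F power_tuple_def by auto
  moreover have "[W1, W2] \<in> weights [n, 1, m]"
    using W by (auto simp: weights_def nth_Cons split: nat.splits)
  ultimately show "F \<in> neuromanifold [n, 1, m] r"
    unfolding neuromanifold_def by blast
qed

section \<open>Symmetric rank at most one\<close>

lemma Inf_enat_image_eq_enatD:
  assumes "Inf (enat ` K) = enat k"
  shows "k \<in> K"
proof -
  have "K \<noteq> {}"
    using assms by (auto simp: top_enat_def)
  then have "Inf (enat ` K) \<in> enat ` K"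
    unfolding Inf_enat_def by (auto intro: LeastI)
  with assms show ?thesis by auto
qed

lemma sym_rank_eq_0_iff:
  "sym_rank n r T = 0 \<longleftrightarrow> (\<forall>J\<in>tensor_indices (replicate r n). T J = 0)" (is "_ \<longleftrightarrow> ?Z")
proof -
  let ?K = "{k. \<exists>(c :: nat \<Rightarrow> real) (v :: nat \<Rightarrow> nat \<Rightarrow> real).
     \<forall>J\<in>tensor_indices (replicate r n). T J = (\<Sum>i<k. c i * (\<Prod>j\<leftarrow>J. v i j))}"
  have Z: "0 \<in> ?K \<longleftrightarrow> ?Z"
    by simp
  show ?thesis
  proof
    assume "sym_rank n r T = 0"
    then show ?Z
      unfolding sym_rank_def zero_enat_def by (intro Z[THEN iffD1] Inf_enat_image_eq_enatD)
  next
    assume ?Z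
    then have "Inf (enat ` ?K) \<le> enat 0"
      using Z by (intro Inf_lower) blast
    then show "sym_rank n r T = 0"
      unfolding sym_rank_def by (simp flip: zero_enat_def)
  qed
qed

lemma sym_rank_le_1_iff:
  "sym_rank n r T \<le> 1 \<longleftrightarrow> (\<exists>c v. \<forall>J\<in>tensor_indices (replicate r n). T J = c * (\<Prod>j\<leftarrow>J. v j))"
    (is "_ \<longleftrightarrow> ?Z")
proof -
  let ?K = "{k. \<exists>(c :: nat \<Rightarrow> real) (v :: nat \<Rightarrow> nat \<Rightarrow> real).
     \<forall>J\<in>tensor_indices (replicate r n). T J = (\<Sum>i<k. c i * (\<Prod>j\<leftarrow>J. v i j))}"
  show ?thesis
  proof
    assume le: "sym_rank n r T \<le> 1"
    show ?Z
    proof (cases "sym_rank n r T = 0")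
      case True
      \<comment> \<open>A tensor of rank 0 vanishes, so the coefficient 0 gives a one-term
        decomposition.\<close>
      then show ?thesis
        unfolding sym_rank_eq_0_iff by (intro exI[of _ 0]) simp
    next
      case False
      with le have 1: "sym_rank n r T = 1"
        by (metis antisym ileI1 iless_eSuc0 not_less one_eSuc)
      \<comment> \<open>The infimum is finite and hence attained, so there is an actual
        decomposition with one term.\<close>
      then have "1 \<in> ?K"
        unfolding sym_rank_def one_enat_def by (rule Inf_enat_image_eq_enatD)
      then obtain c :: "nat \<Rightarrow> real" and v :: "nat \<Rightarrow> nat \<Rightarrow> real"
        where "\<forall>J\<in>tensor_indices (replicate r n). T J = c 0 * (\<Prod>j\<leftarrow>J. v 0 j)"
        by auto
      then show ?thesis by blast
    qed
  next
    assume ?Z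
    then obtain c v where "\<forall>J\<in>tensor_indices (replicate r n). T J = c * (\<Prod>j\<leftarrow>J. v j)"
      by blast
    then have "1 \<in> ?K"
      by (intro CollectI exI[of _ "\<lambda>_. c"] exI[of _ "\<lambda>_. v"]) simp
    then have "Inf (enat ` ?K) \<le> enat 1"
      by (intro Inf_lower) blast
    then show "sym_rank n r T \<le> 1"
      unfolding sym_rank_def by (simp add: one_enat_def)
  qed
qed

text \<open>Proportionality is only demanded between tensors of rank exactly one, because the zero
  tensor is a multiple of every tensor while the converse fails. If some tensor has rank one, it
  supplies \<open>v\<close>, and all others are multiples of it; otherwise all are zero.\<close>

lemma neuromanifold_eq_rank_one_tuples:
  "neuromanifold [n, 1, m] r =
      {vec m (\<lambda>k. tensor_poly n r (T k)) | T.
         (\<forall>k<m. T k \<in> sym_tensors n r \<and> sym_rank n r (T k) \<le> 1) \<and>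
         (\<forall>k<m. \<forall>l<m. sym_rank n r (T k) = 1 \<and> sym_rank n r (T l) = 1 \<longrightarrow>
            (\<exists>c. \<forall>J\<in>tensor_indices (replicate r n). T l J = c * T k J))}" (is "_ = ?R")
  unfolding neuromanifold_eq_range
proof (intro equalityI subsetI)
  fix F assume "F \<in> range (power_tuple n r m)"
  then obtain c v where F: "F = power_tuple n r m (c, v)"
    by auto
  define T where "T k = power_tensor n r (c k) v" for k
  have T: "T k J = c k * (\<Prod>j\<leftarrow>J. v j)" if "J \<in> tensor_indices (replicate r n)" for k J
    using that by (simp add: T_def power_tensor_def)
  have "sym_rank n r (T k) \<le> 1" for k
    unfolding sym_rank_le_1_iff using T by blast
  moreover have "\<exists>e. \<forall>J\<in>tensor_indices (replicate r n). T l J = e * T k J"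
    if "sym_rank n r (T k) = 1" for k l
  proof -
    have "c k \<noteq> 0"
    proof
      assume "c k = 0"
      then have "sym_rank n r (T k) = 0"
        unfolding sym_rank_eq_0_iff using T by simp
      with that show False by simp
    qed
    then show ?thesis
      by (intro exI[of _ "c l / c k"]) (simp add: T)
  qed
  moreover have "F = vec m (\<lambda>k. tensor_poly n r (T k))"
    by (simp add: F power_tuple_def T_def)
  moreover have "T k \<in> sym_tensors n r" for k
    by (simp add: T_def power_tensor_in_sym_tensors)
  ultimately show "F \<in> ?R"
    by blast
next
  fix F assume "F \<in> ?R"
  then obtain T where F: "F = vec m (\<lambda>k. tensor_poly n r (T k))"
    and rank: "\<forall>k<m. T k \<in> sym_tensors n r \<and> sym_rank n r (T k) \<le> 1"
    and proportional: "\<forall>k<m. \<forall>l<m. sym_rank n r (T k) = 1 \<and> sym_rank n r (T l) = 1 \<longrightarrow>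
      (\<exists>c. \<forall>J\<in>tensor_indices (replicate r n). T l J = c * T k J)"
    by (elim CollectE exE conjE) (rule that)
  have rank01: "sym_rank n r (T k) = 0 \<or> sym_rank n r (T k) = 1" if "k < m" for k
    using rank that by (metis antisym ileI1 iless_eSuc0 not_less one_eSuc)
  have "\<exists>c v. \<forall>k<m. \<forall>J\<in>tensor_indices (replicate r n). T k J = c k * (\<Prod>j\<leftarrow>J. v j)"
  proof (cases "\<exists>k<m. sym_rank n r (T k) = 1")
    case False
    with rank01 have "\<forall>k<m. sym_rank n r (T k) = 0"
      by blast
    then show ?thesis
      unfolding sym_rank_eq_0_iff by (intro exI[of _ "\<lambda>_. 0"]) simp
  next
    case True
    then obtain k where k: "k < m" "sym_rank n r (T k) = 1"
      by blast
    then obtain c v where cv: "\<And>J. J \<in> tensor_indices (replicate r n) \<Longrightarrow> T k J = c * (\<Prod>j\<leftarrow>J. v j)"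
      using rank sym_rank_le_1_iff by blast
    have "\<exists>e. \<forall>J\<in>tensor_indices (replicate r n). T l J = e * T k J" if "l < m" for l
    proof (cases "sym_rank n r (T l) = 0")
      case True
      then show ?thesis
        unfolding sym_rank_eq_0_iff by (intro exI[of _ 0]) simp
    next
      case False
      then show ?thesis
        using proportional k that rank01 by blast
    qed
    then obtain e where "\<And>l J. l < m \<Longrightarrow> J \<in> tensor_indices (replicate r n) \<Longrightarrow> T l J = e l * T k J"
      by metis
    then show ?thesis
      by (intro exI[of _ "\<lambda>l. e l * c"] exI[of _ v]) (simp add: cv)
  qed
  then obtain c v where
    cv: "\<And>k J. k < m \<Longrightarrow> J \<in> tensor_indices (replicate r n) \<Longrightarrow> T k J = c k * (\<Prod>j\<leftarrow>J. v j)"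
    by blast
  have "F = power_tuple n r m (c, v)"
    unfolding F power_tuple_def
    by (intro eq_vecI) (auto simp: cv power_tensor_def intro!: tensor_poly_cong)
  then show "F \<in> range (power_tuple n r m)"
    by blast
qed

subsection \<open>Toric coordinates\<close>

definition multidegree :: "(nat \<times> nat multiset) multiset \<Rightarrow> nat multiset \<times> nat multiset" where
  "multidegree P = (image_mset fst P, \<Sum>\<^sub># (image_mset snd P))"

text \<open>As the tensors are symmetric, a multiset of indices stands for all its orderings, so
  each cell is one independent coordinate.\<close>

definition cells :: "nat \<Rightarrow> nat \<Rightarrow> nat \<Rightarrow> (nat \<times> nat multiset) set" where
  "cells n r m = {(k, M). k < m \<and> size M = r \<and> set_mset M \<subseteq> {..<n}}"

text \<open>Sorting merely picks a representative: \<open>tensor_entry\<close> sees the index list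
  only through its monomial.\<close>

definition entry :: "nat \<Rightarrow> nat \<Rightarrow> nat \<times> nat multiset \<Rightarrow> (nat \<times> nat monomial) mpoly" where
  "entry n r x = tensor_entry n r (fst x) (sorted_list_of_multiset (snd x))"

definition entries_prod ::
  "nat \<Rightarrow> nat \<Rightarrow> (nat \<times> nat multiset) multiset \<Rightarrow> (nat \<times> nat monomial) mpoly" where
  "entries_prod n r P = (\<Prod>x\<in>#P. entry n r x)"

lemma multidegree_add_mset:
  "multidegree (add_mset (k, M) P) =
     (add_mset k (fst (multidegree P)), M + snd (multidegree P))"
  by (simp add: multidegree_def)

lemma entries_prod_empty [simp]: "entries_prod n r {#} = 1"
  and entries_prod_add_mset [simp]:
    "entries_prod n r (add_mset x P) = entry n r x * entries_prod n r P"
  by (simp_all add: entries_prod_def)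

lemma index_monomial_sorted [simp]:
  "index_monomial (sort J) = index_monomial J"
  by (simp add: index_monomial_eq_iff)

lemma tensor_entry_eq_entry: "tensor_entry n r k J = entry n r (k, mset J)"
  by (simp add: entry_def tensor_entry_def)

lemma tensor_indices_iff_cells:
  "k < m \<Longrightarrow> J \<in> tensor_indices (replicate r n) \<longleftrightarrow> (k, mset J) \<in> cells n r m"
  by (auto simp: tensor_indices_replicate cells_def)

lemma cells_sorted_list:
  assumes "(k, M) \<in> cells n r m"
  shows "k < m" "sorted_list_of_multiset M \<in> tensor_indices (replicate r n)"
proof -
  show "k < m"
    using assms by (simp add: cells_def)
  then show "sorted_list_of_multiset M \<in> tensor_indices (replicate r n)"
    using tensor_indices_iff_cells[of k m "sorted_list_of_multiset M" r n] assms by simp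
qed

lemma coord_eval_simps:
  "coord_eval F (p + q) = coord_eval F p + coord_eval F q"
  "coord_eval F (p * q) = coord_eval F p * coord_eval F q"
  "coord_eval F (p - q) = coord_eval F p - coord_eval F q"
  "coord_eval F 1 = 1"
  "coord_eval F 0 = 0"
  "coord_eval F (Const c) = c"
  "coord_eval F (sum f A) = (\<Sum>a\<in>A. coord_eval F (f a))"
proof -
  have "eval x (p - q) + eval x q = eval x p" for x :: "nat \<times> nat monomial \<Rightarrow> real"
    by (simp flip: eval_add)
  then show "coord_eval F (p - q) = coord_eval F p - coord_eval F q"
    unfolding coord_eval_def by (metis add_diff_cancel_right')
qed (simp_all add: coord_eval_def eval_add eval_mult eval_sum)

lemma coord_eval_power_tuple_entry:
  assumes "x \<in> cells n r m"
  shows "coord_eval (power_tuple n r m z) (entry n r x) = fst z (fst x) * (\<Prod>j\<in>#snd x. snd z j)"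
proof -
  obtain k M where x: "x = (k, M)" by force
  note kM = cells_sorted_list[OF assms[unfolded x]]
  have "coord_eval (power_tuple n r m z) (entry n r x)
      = power_tensor n r (fst z k) (snd z) (sorted_list_of_multiset M)"
    unfolding power_tuple_def entry_def x fst_conv snd_conv
    by (rule coord_eval_tensor_entry[OF _ kM]) (rule power_tensor_in_sym_tensors)
  also have "\<dots> = fst z k * (\<Prod>j\<in>#M. snd z j)"
    using kM by (simp add: power_tensor_def flip: prod_mset_prod_list)
  finally show ?thesis
    by (simp add: x)
qed

text \<open>The toric property: along the parametrization, products of entries become monomials in
  the parameters, with \<open>multidegree\<close> as the exponent.\<close>

lemma coord_eval_power_tuple_entries_prod:
  assumes "set_mset P \<subseteq> cells n r m"
  shows "coord_eval (power_tuple n r m z) (entries_prod n r P) = character (multidegree P) z"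
  using assms
proof (induction P)
  case empty
  show ?case by (simp add: coord_eval_simps character_def multidegree_def)
next
  case (add x P)
  then show ?case
    by (cases x) (simp add: coord_eval_simps coord_eval_power_tuple_entry character_def multidegree_def
      mult_ac)
qed

lemma Const_in_carrier: "Const c \<in> carrier (coord_ring n r m)"
  by (auto simp: coord_ring_def Const_def)

lemma entry_in_carrier:
  assumes "x \<in> cells n r m"
  shows "entry n r x \<in> carrier (coord_ring n r m)"
proof -
  obtain k M where x: "x = (k, M)" by force
  have "(k, index_monomial (sorted_list_of_multiset M)) \<in> coords n r m"
    using cells_sorted_list assms index_monomial_in_monomials by (auto simp: x coords_def)
  then show ?thesis
    unfolding entry_def tensor_entry_def x
    by (intro coord_ring_mult_closed) (auto simp: coord_ring_def Const_def Var_def)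
qed

lemma entries_prod_in_carrier:
  "set_mset P \<subseteq> cells n r m \<Longrightarrow> entries_prod n r P \<in> carrier (coord_ring n r m)"
  by (induction P) (simp_all add: coord_ring_mult_closed entry_in_carrier)

lemma coord_ring_diff_closed:
  assumes "p \<in> carrier (coord_ring n r m)" "q \<in> carrier (coord_ring n r m)"
  shows "p - q \<in> carrier (coord_ring n r m)"
  using coord_ring_add_closed[OF assms(1), of "- q"] assms(2) by (simp add: coord_ring_def)

text \<open>Both products restrict to the same character on the neuromanifold. These binomials are
  the only equations that the proof of closedness uses.\<close>

lemma toric_binomial_in_vanishing_ideal:
  assumes "set_mset P \<subseteq> cells n r m" "set_mset Q \<subseteq> cells n r m" "multidegree P = multidegree Q"
  shows "entries_prod n r P - entries_prod n r Q
    \<in> vanishing_ideal n r m (neuromanifold [n, 1, m] r)"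
  using assms unfolding neuromanifold_eq_range
  by (auto simp: vanishing_ideal_def coord_eval_simps
      coord_eval_power_tuple_entries_prod coord_ring_diff_closed entries_prod_in_carrier)

section \<open>Ideals of the coordinate ring and Zariski closedness\<close>

lemma ideal_coord_ring_closed:
  assumes "ideal I (coord_ring n r m)"
  shows "0 \<in> I" "p \<in> I \<Longrightarrow> q \<in> I \<Longrightarrow> p + q \<in> I"
    "p \<in> I \<Longrightarrow> q \<in> carrier (coord_ring n r m) \<Longrightarrow> q * p \<in> I"
    "I \<subseteq> carrier (coord_ring n r m)"
proof -
  interpret ideal I "coord_ring n r m" by fact
  show "0 \<in> I" using additive_subgroup.zero_closed[OF is_additive_subgroup] by simp
  show "p \<in> I \<Longrightarrow> q \<in> I \<Longrightarrow> p + q \<in> I" using additive_subgroup.a_closed[OF is_additive_subgroup, of p q] by simp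
  show "p \<in> I \<Longrightarrow> q \<in> carrier (coord_ring n r m) \<Longrightarrow> q * p \<in> I"
    using I_l_closed[of p q] by simp
  show "I \<subseteq> carrier (coord_ring n r m)" using a_subset .
qed

lemma ideal_vanishing_ideal: "ideal (vanishing_ideal n r m A) (coord_ring n r m)"
proof (rule idealI)
  show "ring (coord_ring n r m)"
    by (rule cring.axioms(1)[OF cring_coord_ring])
  have grp: "group (add_monoid (coord_ring n r m))"
    using cring_coord_ring[of n r m]
    by (simp add: cring_def ring_def abelian_group_def abelian_group_axioms_def comm_group_def)
  show "subgroup (vanishing_ideal n r m A) (add_monoid (coord_ring n r m))"
  proof (rule group.subgroupI[OF grp])
    fix p assume p: "p \<in> vanishing_ideal n r m A"
    interpret cring "coord_ring n r m" by (rule cring_coord_ring)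
    have "\<ominus>\<^bsub>coord_ring n r m\<^esub> p = - p"
      using p coord_ring_diff_closed[of 0 n r m p]
      by (intro minus_equality) (auto simp: vanishing_ideal_def)
    moreover have "0 - p \<in> vanishing_ideal n r m A"
      using p coord_ring_diff_closed[of 0 n r m p]
      by (auto simp: vanishing_ideal_def coord_eval_simps simp del: diff_0)
    ultimately show "inv\<^bsub>add_monoid (coord_ring n r m)\<^esub> p \<in> vanishing_ideal n r m A"
      by (simp add: a_inv_def)
  next
    show "vanishing_ideal n r m A \<noteq> {}"
      by (auto simp: vanishing_ideal_def coord_eval_simps intro!: exI[of _ 0])
  qed (auto simp: vanishing_ideal_def coord_eval_simps coord_ring_add_closed)
qed (auto simp: vanishing_ideal_def coord_eval_simps coord_ring_mult_closed)

text \<open>The neuromanifold is shown to be the zero locus of its own vanishing ideal. The work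
  lies in recovering parameters \<open>c\<close> and \<open>v\<close> for a point \<open>F\<close>
  of that locus.\<close>

lemma zariski_closed_neuromanifold:
  assumes "n > 0"
  shows "zariski_closed n r m (neuromanifold [n, 1, m] r)"
proof -
  let ?I = "vanishing_ideal n r m (neuromanifold [n, 1, m] r)"
  have "zero_locus n r m ?I \<subseteq> neuromanifold [n, 1, m] r"
  proof
    fix F assume F: "F \<in> zero_locus n r m ?I"
    then have hom: "F \<in> carrier_vec m" "\<And>k. k < m \<Longrightarrow> F $ k \<in> hom_polys n r"
      by (auto simp: zero_locus_def hom_tuples_def)
    then have "\<exists>T. T \<in> sym_tensors n r \<and> tensor_poly n r T = F $ k" if "k < m" for k
      using bij_betw_tensor_poly[of n r] that unfolding bij_betw_def by (metis imageE)
    then obtain T where T: "\<And>k. k < m \<Longrightarrow> T k \<in> sym_tensors n r"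
      "\<And>k. k < m \<Longrightarrow> tensor_poly n r (T k) = F $ k"
      by metis
    have F_eq: "F = vec m (\<lambda>k. tensor_poly n r (T k))"
      using hom T by (intro eq_vecI) auto
    define f where "f x = coord_eval F (entry n r x)" for x
    have f_T: "f (k, mset J) = T k J" if "k < m" "J \<in> tensor_indices (replicate r n)" for k J
      unfolding f_def F_eq tensor_entry_eq_entry[symmetric]
      by (rule coord_eval_tensor_entry) (use T that in auto)
    have f_prod: "coord_eval F (entries_prod n r P) = (\<Prod>x\<in>#P. f x)" for P
      by (induction P) (simp_all add: coord_eval_simps f_def)
    have toric: "(\<Prod>x\<in>#P. f x) = (\<Prod>x\<in>#Q. f x)"
      if "set_mset P \<subseteq> cells n r m" "set_mset Q \<subseteq> cells n r m" "multidegree P = multidegree Q"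
      for P Q
    proof -
      have "coord_eval F (entries_prod n r P - entries_prod n r Q) = 0"
        using F toric_binomial_in_vanishing_ideal[OF that] by (auto simp: zero_locus_def)
      then show ?thesis
        by (simp add: coord_eval_simps f_prod)
    qed
    have "\<exists>c v. \<forall>k M. (k, M) \<in> cells n r m \<longrightarrow> f (k, M) = c k * (\<Prod>j\<in>#M. v j)"
    proof (cases "\<exists>x\<in>cells n r m. f x \<noteq> 0")
      case False
      then show ?thesis
        by (intro exI[of _ "\<lambda>_. 0"]) auto
    next
      case True
      then obtain k0 M0 where M0: "(k0, M0) \<in> cells n r m" "f (k0, M0) \<noteq> 0"
        by auto
      have k0: "k0 < m" and size_M0: "size M0 = r" and set_M0: "set_mset M0 \<subseteq> {..<n}"
        using M0(1) by (auto simp: cells_def)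
      \<comment> \<open>On both sides \<open>k0\<close> occurs \<open>r\<close> times and every
        index of \<open>M0\<close> occurs \<open>r\<close> times as often as in \<open>M0\<close>. A
        nonzero entry thus forces nonzero diagonal entries.\<close>
      have "(\<Prod>j\<in>#M0. f (k0, replicate_mset r j)) = f (k0, M0) ^ r"
      proof -
        let ?P = "image_mset (\<lambda>j. (k0, replicate_mset r j)) M0"
        let ?Q = "replicate_mset r (k0, M0)"
        have sums: "\<Sum>\<^sub># (image_mset (replicate_mset r) M) = repeat_mset r M"
          "\<Sum>\<^sub># (replicate_mset r M) = repeat_mset r M" for M :: "nat multiset"
          subgoal by (induction M) simp_all
          subgoal by (induction r) simp_all
          done
        have "multidegree ?P = multidegree ?Q"
          by (simp add: multidegree_def sums multiset.map_comp comp_def image_mset_const_eq size_M0)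
        then have "(\<Prod>x\<in>#?P. f x) = (\<Prod>x\<in>#?Q. f x)"
          by (intro toric) (use M0(1) k0 set_M0 in \<open>auto simp: cells_def split: if_splits\<close>)
        then show ?thesis
          by (simp add: multiset.map_comp comp_def)
      qed
      then have diag: "\<forall>j\<in>#M0. f (k0, replicate_mset r j) \<noteq> 0"
        using M0(2) by (metis (no_types, lifting) image_eqI power_not_zero prod_mset_zero_iff set_image_mset)
      obtain j0 where j0: "j0 < n" "f (k0, replicate_mset r j0) \<noteq> 0"
      proof (cases "M0 = {#}")
        case True
        \<comment> \<open>Here \<open>r = 0\<close>: the only multiset of indices is empty and every
          \<open>j0\<close> works; \<open>n > 0\<close> provides the index 0.\<close>
        then show ?thesis
          using that[of 0] assms M0(2) size_M0 by simp
      next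
        case False
        then obtain j where "j \<in># M0" by blast
        then show ?thesis
          using that[of j] diag set_M0 by auto
      qed
      define A where "A = f (k0, replicate_mset r j0)"
      \<comment> \<open>On a rank-one tensor this line of entries through the diagonal entry
        \<open>A\<close> is proportional to \<open>v\<close>. For \<open>r = 0\<close> the truncated
        difference does no harm, since \<open>w\<close> is then only multiplied over the empty
        multiset.\<close>
      define w where "w j = f (k0, add_mset j (replicate_mset (r - 1) j0))" for j
      have fA: "f (k, M) * A ^ r = f (k, replicate_mset r j0) * (\<Prod>j\<in>#M. w j)"
        if kM: "(k, M) \<in> cells n r m" for k M
      proof -
        \<comment> \<open>Both products have \<open>r + 1\<close> factors: \<open>k\<close> occurs
          once and \<open>k0\<close> another \<open>r\<close> times, and the indices are those of
          \<open>M\<close> together with \<open>r * r\<close> copies of \<open>j0\<close>.\<close>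
        let ?P = "add_mset (k, M) (replicate_mset r (k0, replicate_mset r j0))"
        let ?Q = "add_mset (k, replicate_mset r j0)
          (image_mset (\<lambda>j. (k0, add_mset j (replicate_mset (r - 1) j0))) M)"
        have k: "k < m" and size_M: "size M = r" and set_M: "set_mset M \<subseteq> {..<n}"
          using kM by (auto simp: cells_def)
        have sums: "\<Sum>\<^sub># (image_mset (\<lambda>j. add_mset j R) M') = M' + repeat_mset (size M') R"
          "\<Sum>\<^sub># (replicate_mset s R) = repeat_mset s R" for M' R :: "nat multiset" and s
          subgoal by (induction M') simp_all
          subgoal by (induction s) simp_all
          done
        have "r + r * (r - 1) = r * r"
          by (cases r) simp_all
        then have rr: "repeat_mset r (replicate_mset r j0)
            = replicate_mset r j0 + repeat_mset r (replicate_mset (r - 1) j0)"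
          by (intro multiset_eqI) simp
        have "multidegree ?P = multidegree ?Q"
          unfolding multidegree_add_mset
          by (simp add: multidegree_def sums multiset.map_comp comp_def image_mset_const_eq size_M rr
              union_ac)
        moreover have "(k0, add_mset j (replicate_mset (r - 1) j0)) \<in> cells n r m" if "j \<in># M" for j
          using that size_M set_M j0 k0 by (cases r) (auto simp: cells_def split: if_splits)
        ultimately have "(\<Prod>x\<in>#?P. f x) = (\<Prod>x\<in>#?Q. f x)"
          by (intro toric) (use kM k k0 j0 in \<open>auto simp: cells_def split: if_splits\<close>)
        then show ?thesis
          by (simp add: multiset.map_comp comp_def A_def w_def)
      qed
      have w_div: "(\<Prod>j\<in>#M. w j / A) = (\<Prod>j\<in>#M. w j) / A ^ size M" for M
        by (induction M) simp_all
      have "A \<noteq> 0"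
        using j0 by (simp add: A_def)
      \<comment> \<open>Since \<open>M\<close> has \<open>r\<close> elements, the factor
        \<open>A ^ r\<close> can be distributed as one division by \<open>A\<close> per
        index.\<close>
      have "f (k, M) = f (k, replicate_mset r j0) * (\<Prod>j\<in>#M. w j / A)"
        if kM: "(k, M) \<in> cells n r m" for k M
      proof -
        have "size M = r"
          using kM by (simp add: cells_def)
        then show ?thesis
          using fA[OF kM] \<open>A \<noteq> 0\<close> unfolding w_div by (simp add: eq_divide_eq)
      qed
      then show ?thesis
        by (intro exI[of _ "\<lambda>k. f (k, replicate_mset r j0)"] exI[of _ "\<lambda>j. w j / A"]) blast
    qed
    then obtain c v where cv: "\<And>k M. (k, M) \<in> cells n r m \<Longrightarrow> f (k, M) = c k * (\<Prod>j\<in>#M. v j)"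
      by blast
    have "T k J = c k * (\<Prod>j\<leftarrow>J. v j)" if "k < m" "J \<in> tensor_indices (replicate r n)" for k J
      using f_T[OF that] cv[of k "mset J"] that
      by (simp add: tensor_indices_iff_cells flip: prod_mset_prod_list)
    then have "F = power_tuple n r m (c, v)"
      unfolding F_eq power_tuple_def
      by (intro eq_vecI) (auto simp: power_tensor_def intro!: tensor_poly_cong)
    then show "F \<in> neuromanifold [n, 1, m] r"
      unfolding neuromanifold_eq_range by simp
  qed
  moreover have "neuromanifold [n, 1, m] r \<subseteq> zero_locus n r m ?I"
    using neuromanifold_subset_hom_tuples[of "[n, 1, m]" r]
    by (auto simp: zero_locus_def vanishing_ideal_def)
  ultimately show ?thesis
    unfolding zariski_closed_def
    by (intro exI[of _ ?I]) (auto simp: vanishing_ideal_def)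
qed

lemma neurovariety_eq_neuromanifold:
  assumes "n > 0"
  shows "neurovariety [n, 1, m] r = neuromanifold [n, 1, m] r"
  using hull_same[of "zariski_closed n r m", OF zariski_closed_neuromanifold[OF assms]]
  by (simp add: neurovariety_def)

subsection \<open>The ideal of the neurovariety\<close>

text \<open>Quadratic binomials that swap one index between two entries while \<open>k\<close> and
  \<open>l\<close> stay in place. Isolating this property keeps the combinatorics of products
  separate from the minors.\<close>

definition exchange_closed ::
  "nat \<Rightarrow> nat \<Rightarrow> nat \<Rightarrow> (nat \<times> nat monomial) mpoly set \<Rightarrow> bool" where
  "exchange_closed n r m I \<longleftrightarrow> (\<forall>k l a b A B.
     (k, add_mset a A) \<in> cells n r m \<longrightarrow> (l, add_mset b B) \<in> cells n r m \<longrightarrow>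
     entry n r (k, add_mset a A) * entry n r (l, add_mset b B)
       - entry n r (k, add_mset b A) * entry n r (l, add_mset a B) \<in> I)"

text \<open>Induction on the number of indices of \<open>N\<close> missing from \<open>M\<close>. A
  missing index \<open>b\<close> must occur in some factor of \<open>P\<close>, and one exchange
  trades it for an index \<open>a\<close> that \<open>M\<close> has in excess.\<close>

lemma exchange_towards:
  assumes I: "ideal I (coord_ring n r m)" and ex: "exchange_closed n r m I"
    and "(k, M) \<in> cells n r m" "set_mset P \<subseteq> cells n r m" "size N = r"
    and "N \<subseteq># M + snd (multidegree P)"
  shows "\<exists>P'. set_mset P' \<subseteq> cells n r m \<and>
    multidegree (add_mset (k, M) P) = multidegree (add_mset (k, N) P') \<and>
    entries_prod n r (add_mset (k, M) P) - entries_prod n r (add_mset (k, N) P') \<in> I"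
  using assms(3-)
proof (induction "size (N - M)" arbitrary: M P)
  case 0
  then have "N \<subseteq># M"
    by (simp add: Diff_eq_empty_iff_mset)
  moreover have "size M = size N"
    using 0 by (simp add: cells_def)
  ultimately have "N = M"
    by (metis subset_mset.le_imp_less_or_eq mset_subset_size less_irrefl)
  with 0 show ?case
    using ideal_coord_ring_closed(1)[OF I] by (intro exI[of _ P]) simp
next
  case (Suc s)
  have size_M: "size M = r"
    using Suc.prems(1) by (simp add: cells_def)
  obtain b where b: "b \<in># N - M"
    using Suc.hyps(2) by (metis nat.distinct(1) size_empty multiset_nonemptyE)
  \<comment> \<open>\<open>M\<close> and \<open>N\<close> have equal size, so a missing index is
    always matched by one in excess.\<close>
  have "size (M - N) = size (N - M)"
    using size_M Suc.prems(3) by (simp add: size_Diff_subset_Int subset_mset.inf_commute)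
  then obtain a where a: "a \<in># M - N"
    using Suc.hyps(2) by (metis nat.distinct(1) size_empty multiset_nonemptyE)
  define A where "A = M - {#a#}"
  have M: "M = add_mset a A"
    using a by (simp add: A_def in_diffD)
  have "count M b < count N b" "count N b \<le> count M b + count (snd (multidegree P)) b"
    using b Suc.prems(4) by (simp_all add: in_diff_count mset_subset_eq_count flip: count_union)
  then have "b \<in># snd (multidegree P)"
    by (simp flip: count_greater_zero_iff)
  then obtain l L where l: "(l, L) \<in># P" "b \<in># L"
    by (auto simp: multidegree_def)
  define B Q where "B = L - {#b#}" and "Q = P - {#(l, L)#}"
  have L: "L = add_mset b B" and P: "P = add_mset (l, add_mset b B) Q"
    using l by (simp_all add: B_def Q_def)
  have cells: "(k, add_mset a A) \<in> cells n r m" "(l, add_mset b B) \<in> cells n r m"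
    "set_mset Q \<subseteq> cells n r m"
    using Suc.prems by (simp_all add: M P)
  then have cells': "(k, add_mset b A) \<in> cells n r m"
    "set_mset (add_mset (l, add_mset a B) Q) \<subseteq> cells n r m"
    by (auto simp: cells_def)
  have "N - add_mset b A = (N - M) - {#b#}"
    using a b by (intro multiset_eqI) (auto simp: M in_diff_count)
  moreover have "size (N - M - {#b#}) = s"
    unfolding size_Diff_singleton[OF b] Suc.hyps(2)[symmetric] by simp
  ultimately have "s = size (N - add_mset b A)"
    by (simp only:)
  moreover have "N \<subseteq># add_mset b A + snd (multidegree (add_mset (l, add_mset a B) Q))"
    using Suc.prems(4) by (simp add: M P multidegree_add_mset add_mset_commute)
  ultimately obtain P' where P': "set_mset P' \<subseteq> cells n r m"
    "multidegree (add_mset (k, add_mset b A) (add_mset (l, add_mset a B) Q))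
      = multidegree (add_mset (k, N) P')"
    "entries_prod n r (add_mset (k, add_mset b A) (add_mset (l, add_mset a B) Q))
      - entries_prod n r (add_mset (k, N) P') \<in> I"
    using Suc.hyps(1)[of "add_mset b A" "add_mset (l, add_mset a B) Q"] cells' Suc.prems(3) by blast
  \<comment> \<open>The exchange binomial times the untouched factors; added to the difference from
    the induction hypothesis, it telescopes.\<close>
  have "entries_prod n r Q * (entry n r (k, add_mset a A) * entry n r (l, add_mset b B)
      - entry n r (k, add_mset b A) * entry n r (l, add_mset a B)) \<in> I"
    using ex cells by (intro ideal_coord_ring_closed(3)[OF I] entries_prod_in_carrier)
      (auto simp: exchange_closed_def)
  with P'(3) have "entries_prod n r (add_mset (k, add_mset b A) (add_mset (l, add_mset a B) Q))
      - entries_prod n r (add_mset (k, N) P')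
    + entries_prod n r Q * (entry n r (k, add_mset a A) * entry n r (l, add_mset b B)
      - entry n r (k, add_mset b A) * entry n r (l, add_mset a B)) \<in> I"
    by (rule ideal_coord_ring_closed(2)[OF I])
  then have "entries_prod n r (add_mset (k, M) P) - entries_prod n r (add_mset (k, N) P') \<in> I"
    by (simp add: M P algebra_simps)
  moreover have "multidegree (add_mset (k, M) P) = multidegree (add_mset (k, N) P')"
    unfolding P'(2)[symmetric] by (simp add: M P multidegree_add_mset)
  ultimately show ?case
    using P'(1) by blast
qed

text \<open>Induction on \<open>Q\<close>: some factor of \<open>P\<close> has the same tensor
  number as the first factor of \<open>Q\<close>. Exchanges turn it into that factor, which is then
  split off from both products.\<close>

lemma exchange_connected:
  assumes I: "ideal I (coord_ring n r m)" and ex: "exchange_closed n r m I"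
    and "set_mset P \<subseteq> cells n r m" "set_mset Q \<subseteq> cells n r m" "multidegree P = multidegree Q"
  shows "entries_prod n r P - entries_prod n r Q \<in> I"
  using assms(3-)
proof (induction Q arbitrary: P)
  case empty
  then show ?case
    using ideal_coord_ring_closed(1)[OF I] by (simp add: multidegree_def)
next
  case (add x Q)
  obtain k N where x: "x = (k, N)" by force
  have "k \<in># fst (multidegree P)"
    using add.prems(3) by (simp add: x multidegree_add_mset)
  then obtain M where M: "(k, M) \<in># P"
    by (auto simp: multidegree_def)
  define P0 where "P0 = P - {#(k, M)#}"
  have P: "P = add_mset (k, M) P0"
    using M by (simp add: P0_def)
  have "N \<subseteq># M + snd (multidegree P0)"
    using add.prems(3) by (simp add: x P multidegree_add_mset)
  moreover have "size N = r"
    using add.prems(2) by (simp add: x cells_def)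
  ultimately obtain P' where P': "set_mset P' \<subseteq> cells n r m"
    "multidegree (add_mset (k, M) P0) = multidegree (add_mset (k, N) P')"
    "entries_prod n r (add_mset (k, M) P0) - entries_prod n r (add_mset (k, N) P') \<in> I"
    using exchange_towards[OF I ex, of k M P0 N] add.prems(1) P by auto
  have "multidegree P' = multidegree Q"
    using P'(2) add.prems(3) by (simp add: x P multidegree_add_mset prod_eq_iff)
  then have "entry n r x * (entries_prod n r P' - entries_prod n r Q) \<in> I"
    using add P'(1) by (intro ideal_coord_ring_closed(3)[OF I] entry_in_carrier) auto
  with P'(3) have "entries_prod n r (add_mset (k, M) P0) - entries_prod n r (add_mset (k, N) P')
      + entry n r x * (entries_prod n r P' - entries_prod n r Q) \<in> I"
    by (rule ideal_coord_ring_closed(2)[OF I])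
  then show ?case
    by (simp add: x P algebra_simps)
qed

section \<open>Polynomials as combinations of products of entries\<close>

lemma Const_mult: "Const (a * b) = Const a * Const b"
  and Const_0: "Const 0 = 0"
  and Const_1: "Const 1 = 1"
  and Const_sum: "Const (sum f S) = (\<Sum>s\<in>S. Const (f s))"
proof -
  show "Const (sum f S) = (\<Sum>s\<in>S. Const (f s))"
    by (induction S rule: infinite_finite_induct) (simp_all add: Const_def single_add)
qed (simp_all add: Const_def mult_single)

text \<open>An entry is a coefficient coordinate divided by the number of orderings of its indices.
  That number is positive, so the scaling can be undone.\<close>

lemma Var_eq_Const_mult_entry:
  assumes "v \<in> coords n r m"
  obtains a x where "x \<in> cells n r m" "Var v = Const a * entry n r x"
proof -
  obtain k \<mu> where v: "v = (k, \<mu>)" and k: "k < m" "\<mu> \<in> monomials n r"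
    using assms by (auto simp: coords_def)
  obtain J where J: "J \<in> tensor_indices (replicate r n)" "index_monomial J = \<mu>"
    using k(2) by (rule ex_index_monomial)
  let ?c = "real (card {J' \<in> tensor_indices (replicate r n). index_monomial J' = index_monomial J})"
  have "?c > 0"
    using index_class_card_pos[OF J(1)] by simp
  then have "(Const ?c * Const (1 / ?c) :: (nat \<times> nat monomial) mpoly) = 1"
    by (simp add: Const_1 flip: Const_mult)
  then have "Var v = Const ?c * tensor_entry n r k J"
    unfolding tensor_entry_def mult.assoc[symmetric] by (simp add: J v)
  moreover have "(k, mset J) \<in> cells n r m"
    using tensor_indices_iff_cells[OF k(1)] J(1) by blast
  ultimately show thesis
    using that unfolding tensor_entry_eq_entry by blast
qed

text \<open>Induction on the total degree, splitting off one variable at a time and replacing it by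
  a scaled entry.\<close>

lemma single_eq_Const_mult_entries_prod:
  assumes "Poly_Mapping.keys \<nu> \<subseteq> coords n r m"
  shows "\<exists>a P. set_mset P \<subseteq> cells n r m \<and>
    Poly_Mapping.single \<nu> c = Const a * entries_prod n r P"
  using assms
proof (induction "\<Sum>v\<in>Poly_Mapping.keys \<nu>. Poly_Mapping.lookup \<nu> v" arbitrary: \<nu> rule: less_induct)
  case less
  show ?case
  proof (cases "\<nu> = 0")
    case True
    then show ?thesis
      by (intro exI[of _ c] exI[of _ "{#}"]) (simp add: Const_def)
  next
    case False
    then obtain v where v: "v \<in> Poly_Mapping.keys \<nu>"
      by (metis all_not_in_conv keys_eq_empty)
    define \<nu>' where "\<nu>' = \<nu> - Poly_Mapping.single v 1"
    have lookup: "Poly_Mapping.lookup \<nu>' u = Poly_Mapping.lookup \<nu> u - (if u = v then 1 else 0)" for u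
      by (simp add: \<nu>'_def lookup_minus lookup_single when_def)
    have \<nu>: "\<nu> = Poly_Mapping.single v 1 + \<nu>'"
      using v by (intro poly_mapping_eqI)
        (auto simp: lookup lookup_add lookup_single when_def in_keys_iff)
    have keys: "Poly_Mapping.keys \<nu>' \<subseteq> Poly_Mapping.keys \<nu>"
      by (auto simp: in_keys_iff lookup)
    have "(\<Sum>u\<in>Poly_Mapping.keys \<nu>'. Poly_Mapping.lookup \<nu>' u)
        = (\<Sum>u\<in>Poly_Mapping.keys \<nu>. Poly_Mapping.lookup \<nu>' u)"
      using keys by (intro sum.mono_neutral_left) (auto simp: in_keys_iff)
    also have "\<dots> < (\<Sum>u\<in>Poly_Mapping.keys \<nu>. Poly_Mapping.lookup \<nu> u)"
      using v by (intro sum_strict_mono_ex1) (auto simp: lookup in_keys_iff intro!: bexI[of _ v])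
    finally obtain a P where P: "set_mset P \<subseteq> cells n r m"
      "Poly_Mapping.single \<nu>' c = Const a * entries_prod n r P"
      using less keys by blast
    obtain a' x where x: "x \<in> cells n r m" "Var v = Const a' * entry n r x"
      using v less.prems Var_eq_Const_mult_entry by blast
    have "Poly_Mapping.single \<nu> c = Var v * Poly_Mapping.single \<nu>' c"
      by (simp add: \<nu> Var_def mult_single)
    also have "\<dots> = Const (a' * a) * entries_prod n r (add_mset x P)"
      by (simp add: P x Const_mult mult_ac)
    finally show ?thesis
      using P(1) x(1) by (intro exI[of _ "a' * a"] exI[of _ "add_mset x P"]) auto
  qed
qed

lemma vanishing_ideal_subset_exchange_closed:
  assumes I: "ideal I (coord_ring n r m)" and ex: "exchange_closed n r m I"
  shows "vanishing_ideal n r m (neuromanifold [n, 1, m] r) \<subseteq> I"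
proof
  fix p assume p: "p \<in> vanishing_ideal n r m (neuromanifold [n, 1, m] r)"
  let ?S = "Poly_Mapping.keys p"
  have "Poly_Mapping.keys \<nu> \<subseteq> coords n r m" if "\<nu> \<in> ?S" for \<nu>
    using p that by (auto simp: vanishing_ideal_def coord_ring_def)
  then have "\<exists>a P. set_mset P \<subseteq> cells n r m \<and>
      Poly_Mapping.single \<nu> (Poly_Mapping.lookup p \<nu>) = Const a * entries_prod n r P"
    if "\<nu> \<in> ?S" for \<nu>
    using single_eq_Const_mult_entries_prod that by blast
  then obtain a P where P: "\<And>\<nu>. \<nu> \<in> ?S \<Longrightarrow> set_mset (P \<nu>) \<subseteq> cells n r m"
    and aP: "\<And>\<nu>. \<nu> \<in> ?S \<Longrightarrow>
      Poly_Mapping.single \<nu> (Poly_Mapping.lookup p \<nu>) = Const (a \<nu>) * entries_prod n r (P \<nu>)"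
    by metis
  have p_eq: "p = (\<Sum>\<nu>\<in>?S. Const (a \<nu>) * entries_prod n r (P \<nu>))"
    using mpoly_as_sum[of p] aP by simp
  define deg where "deg \<nu> = multidegree (P \<nu>)" for \<nu>
  \<comment> \<open>\<open>coef t\<close> collects all terms of multidegree \<open>t\<close>, so it
    is the coefficient of \<open>character t\<close> once \<open>p\<close> is evaluated on the
    neuromanifold; \<open>rep t\<close> selects one such term.\<close>
  define coef where "coef t = (\<Sum>\<nu>\<in>{\<nu>\<in>?S. deg \<nu> = t}. a \<nu>)" for t
  define rep where "rep t = (SOME \<nu>. \<nu> \<in> ?S \<and> deg \<nu> = t)" for t
  have rep: "rep (deg \<nu>) \<in> ?S" "deg (rep (deg \<nu>)) = deg \<nu>" if "\<nu> \<in> ?S" for \<nu>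
    using someI[of "\<lambda>\<nu>'. \<nu>' \<in> ?S \<and> deg \<nu>' = deg \<nu>" \<nu>] that by (auto simp: rep_def)
  have "(\<Sum>t\<in>deg ` ?S. coef t * character t z) = 0" for z
  proof -
    have "0 = coord_eval (power_tuple n r m z) p"
      using p unfolding vanishing_ideal_def neuromanifold_eq_range by (cases z) simp
    also have "\<dots> = (\<Sum>\<nu>\<in>?S. a \<nu> * character (deg \<nu>) z)"
      unfolding p_eq[THEN arg_cong[of _ _ "coord_eval (power_tuple n r m z)"]] coord_eval_simps
      by (rule sum.cong) (simp_all add: coord_eval_power_tuple_entries_prod P deg_def)
    also have "\<dots> = (\<Sum>t\<in>deg ` ?S. \<Sum>\<nu>\<in>{\<nu>\<in>?S. deg \<nu> = t}. a \<nu> * character (deg \<nu>) z)"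
      by (rule sum.image_gen) simp
    also have "\<dots> = (\<Sum>t\<in>deg ` ?S. coef t * character t z)"
      unfolding coef_def sum_distrib_right by (intro sum.cong) auto
    finally show ?thesis by simp
  qed
  then have coef: "coef t = 0" if "t \<in> deg ` ?S" for t
    using character_independent[of "deg ` ?S" coef] that by auto
  \<comment> \<open>With every product replaced by the representative of its multidegree, the sum is
    zero. Subtracting it from \<open>p\<close> leaves binomials of equal multidegree.\<close>
  have "(\<Sum>\<nu>\<in>?S. Const (a \<nu>) * entries_prod n r (P (rep (deg \<nu>))))
      = (\<Sum>t\<in>deg ` ?S. \<Sum>\<nu>\<in>{\<nu>\<in>?S. deg \<nu> = t}. Const (a \<nu>) * entries_prod n r (P (rep (deg \<nu>))))"
    by (rule sum.image_gen) simp
  also have "\<dots> = (\<Sum>t\<in>deg ` ?S. Const (coef t) * entries_prod n r (P (rep t)))"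
    unfolding coef_def Const_sum sum_distrib_right by (intro sum.cong) auto
  also have "\<dots> = 0"
    by (rule sum.neutral) (simp add: coef Const_0)
  finally have "p = (\<Sum>\<nu>\<in>?S. Const (a \<nu>) * (entries_prod n r (P \<nu>) - entries_prod n r (P (rep (deg \<nu>)))))"
    using p_eq by (simp add: right_diff_distrib sum_subtractf)
  also have "\<dots> \<in> I"
  proof -
    have sum_closed: "sum f S \<in> I" if "\<And>s. s \<in> S \<Longrightarrow> f s \<in> I"
      for f :: "_ \<Rightarrow> (nat \<times> nat monomial) mpoly" and S
      using that ideal_coord_ring_closed(1,2)[OF I]
      by (induction S rule: infinite_finite_induct) auto
    show ?thesis
    proof (rule sum_closed)
      fix \<nu> assume \<nu>: "\<nu> \<in> ?S"
      have "entries_prod n r (P \<nu>) - entries_prod n r (P (rep (deg \<nu>))) \<in> I"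
        using rep[OF \<nu>] by (intro exchange_connected[OF I ex] P \<nu>) (simp_all add: deg_def)
      then show "Const (a \<nu>) * (entries_prod n r (P \<nu>) - entries_prod n r (P (rep (deg \<nu>)))) \<in> I"
        by (rule ideal_coord_ring_closed(3)[OF I _ Const_in_carrier])
    qed
  qed
  finally show "p \<in> I" .
qed

section \<open>Minors of the flattenings of the combined tensor\<close>

lemma combine_last:
  assumes "J \<noteq> []" "last J < n"
  shows "combine n T (butlast J @ [k * n + last J]) = T k J"
proof -
  have "(k * n + last J) div n = k" "(k * n + last J) mod n = last J"
    using assms(2) by simp_all
  then show ?thesis
    using assms(1) by (simp add: combine_def)
qed

lemma flattening_minorsI:
  assumes "I1 \<union> I2 = {..<length ns}" "I1 \<inter> I2 = {}"
    and "a \<in> (\<Pi>\<^sub>E i\<in>I1. {..<ns ! i})" "a' \<in> (\<Pi>\<^sub>E i\<in>I1. {..<ns ! i})" "a \<noteq> a'"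
    and "b \<in> (\<Pi>\<^sub>E i\<in>I2. {..<ns ! i})" "b' \<in> (\<Pi>\<^sub>E i\<in>I2. {..<ns ! i})" "b \<noteq> b'"
  shows "minor2 (flattening ns I1 T) a a' b b' \<in> flattening_minors ns T"
  unfolding flattening_minors_def
  by (rule CollectI, intro exI conjI, rule refl) (fact assms)+

lemma flattening_minorsE:
  assumes "p \<in> flattening_minors ns T"
  obtains I1 I2 a a' b b' where "p = minor2 (flattening ns I1 T) a a' b b'"
    "I1 \<union> I2 = {..<length ns}" "I1 \<inter> I2 = {}"
    "a \<in> (\<Pi>\<^sub>E i\<in>I1. {..<ns ! i})" "a' \<in> (\<Pi>\<^sub>E i\<in>I1. {..<ns ! i})"
    "b \<in> (\<Pi>\<^sub>E i\<in>I2. {..<ns ! i})" "b' \<in> (\<Pi>\<^sub>E i\<in>I2. {..<ns ! i})"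
  using assms unfolding flattening_minors_def by (elim CollectE exE conjE) (rule that)

text \<open>An exchange is the minor with rows \<open>a\<close>, \<open>b\<close> and columns
  \<open>(k, A)\<close>, \<open>(l, B)\<close> of the flattening that separates the first index; it
  is zero if the rows or the columns coincide. For \<open>r = 1\<close> there is no such flattening,
  but \<open>n = 1\<close> forces \<open>a = b\<close>, and \<open>m = 1\<close> forces
  \<open>k = l\<close> with \<open>A\<close> and \<open>B\<close> empty.\<close>

lemma exchange_closed_flattening_minors:
  assumes I: "ideal I (coord_ring n r m)"
    and sub: "flattening_minors (combined_format n r m) (combine n (tensor_entry n r)) \<subseteq> I"
    and r1: "r = 1 \<longrightarrow> n = 1 \<or> m = 1"
  shows "exchange_closed n r m I"
  unfolding exchange_closed_def
proof (intro allI impI)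
  fix k l a b A B
  assume cells: "(k, add_mset a A) \<in> cells n r m" "(l, add_mset b B) \<in> cells n r m"
  let ?d = "entry n r (k, add_mset a A) * entry n r (l, add_mset b B)
       - entry n r (k, add_mset b A) * entry n r (l, add_mset a B)"
  have k: "k < m" "l < m" "a < n" "b < n" and AB: "Suc (size A) = r" "Suc (size B) = r"
    "set_mset A \<subseteq> {..<n}" "set_mset B \<subseteq> {..<n}"
    using cells by (auto simp: cells_def)
  consider "a = b" | "k = l" "A = B" | "a \<noteq> b" "(k, A) \<noteq> (l, B)" by blast
  then show "?d \<in> I"
  proof cases
    case 3
    have "r \<noteq> 1"
    proof
      assume "r = 1"
      then have "A = {#}" "B = {#}"
        using AB by simp_all
      with 3 \<open>r = 1\<close> r1 k show False by auto
    qed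
    then have r: "r \<ge> 2"
      using AB by simp
    let ?ns = "combined_format n r m"
    let ?T = "combine n (tensor_entry n r)"
    define row where "row x = (\<lambda>i\<in>{0::nat}. x)" for x :: nat
    \<comment> \<open>The last index also encodes the tensor number \<open>j\<close>, as in
      \<open>combine\<close>. In \<open>col\<close> the positions are shifted by one because
      position 0 belongs to the row.\<close>
    define tail where "tail j M = butlast (sorted_list_of_multiset M) @ [j * n + last (sorted_list_of_multiset M)]"
      for j :: nat and M
    define col where "col j M = (\<lambda>i\<in>{1..<r}. tail j M ! (i - 1))" for j M
    have length_sorted: "length (sorted_list_of_multiset M) = r - 1" if "Suc (size M) = r" for M :: "nat multiset"
      using that by (metis diff_Suc_1 mset_sorted_list_of_multiset size_mset)
    have len: "length ?ns = r"
      using r by (simp add: combined_format_def)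
    have tensor: "flattening ?ns {0} ?T (row x) (col j M) = entry n r (j, add_mset x M)"
      and length_tail: "length (tail j M) = r - 1"
      and col: "col j M \<in> (\<Pi>\<^sub>E i\<in>{1..<r}. {..<?ns ! i})"
      if M: "Suc (size M) = r" "set_mset M \<subseteq> {..<n}" and j: "j < m" for x j M
    proof -
      let ?L = "sorted_list_of_multiset M"
      have len_L: "length ?L = r - 1"
        using M(1) by (rule length_sorted)
      then have L: "?L \<noteq> []"
        using r by auto
      have set_L: "set ?L \<subseteq> {..<n}"
        using M(2) by simp
      then have last_L: "last ?L < n"
        using last_in_set[OF L] by auto
      show length_tail: "length (tail j M) = r - 1"
        using len_L r by (simp add: tail_def)
      \<comment> \<open>The list \<open>x # ?L\<close> need not be sorted, but an entry depends only
        on the multiset of its indices.\<close>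
      have "map (\<lambda>i. if i \<in> {0} then row x i else col j M i) [0..<r] = x # tail j M"
        using r length_tail by (intro nth_equalityI) (auto simp: row_def col_def nth_Cons split: nat.splits)
      also have "\<dots> = butlast (x # ?L) @ [j * n + last (x # ?L)]"
        using L by (simp add: tail_def)
      finally have "flattening ?ns {0} ?T (row x) (col j M) = tensor_entry n r j (x # ?L)"
        unfolding flattening_def len using combine_last[of "x # ?L" n] L last_L by simp
      then show "flattening ?ns {0} ?T (row x) (col j M) = entry n r (j, add_mset x M)"
        by (simp add: tensor_entry_eq_entry)
      have "tail j M ! (i - 1) < ?ns ! i" if i: "i \<in> {1..<r}" for i
      proof (cases "i = r - 1")
        case True
        have "j * n + last ?L < Suc j * n"
          using last_L by simp
        also have "\<dots> \<le> m * n"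
          using j by (intro mult_le_mono1) simp
        finally show ?thesis
          using True len_L r by (simp add: tail_def combined_format_def nth_append mult.commute)
      next
        case False
        then have i_less: "i < r - 1"
          using i by auto
        then have i': "i - 1 < length (butlast ?L)"
          using i len_L by auto
        then have "butlast ?L ! (i - 1) < n"
          using set_L in_set_butlastD[OF nth_mem[OF i']] by auto
        then show ?thesis
          using i' i_less by (simp add: tail_def combined_format_def nth_append)
      qed
      then show "col j M \<in> (\<Pi>\<^sub>E i\<in>{1..<r}. {..<?ns ! i})"
        by (auto simp: col_def)
    qed
    have row: "row x \<in> (\<Pi>\<^sub>E i\<in>{0}. {..<?ns ! i})" if "x < n" for x
      using that r by (auto simp: row_def combined_format_def nth_append)
    have row_neq: "row a \<noteq> row b"
      using 3 by (metis row_def restrict_apply' singletonI)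
    \<comment> \<open>Division by \<open>n\<close> recovers the tensor number from the last index,
      so a column determines the pair of tensor number and multiset.\<close>
    have col_neq: "col k A \<noteq> col l B"
    proof
      assume eq: "col k A = col l B"
      have "tail k A ! i = tail l B ! i" if "i < r - 1" for i
      proof -
        have "Suc i < r"
          using that by linarith
        then show ?thesis
          using fun_cong[OF eq, of "Suc i"] by (simp add: col_def)
      qed
      then have "tail k A = tail l B"
        using length_tail[OF AB(1,3) k(1)] length_tail[OF AB(2,4) k(2)] by (intro nth_equalityI) auto
      then have tail_eq: "butlast (sorted_list_of_multiset A) = butlast (sorted_list_of_multiset B)"
        "k * n + last (sorted_list_of_multiset A) = l * n + last (sorted_list_of_multiset B)"
        by (simp_all add: tail_def)
      have ne: "sorted_list_of_multiset A \<noteq> []" "sorted_list_of_multiset B \<noteq> []"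
        using length_sorted[OF AB(1)] length_sorted[OF AB(2)] r by auto
      then have last: "last (sorted_list_of_multiset A) < n" "last (sorted_list_of_multiset B) < n"
        using last_in_set[OF ne(1)] last_in_set[OF ne(2)] AB(3,4) by auto
      have "k = l"
        using arg_cong[OF tail_eq(2), of "\<lambda>x. x div n"] last by simp
      with tail_eq have "sorted_list_of_multiset A = sorted_list_of_multiset B"
        using ne by (metis add_left_cancel append_butlast_last_id)
      with \<open>k = l\<close> show False
        using 3 by (metis mset_sorted_list_of_multiset)
    qed
    have "minor2 (flattening ?ns {0} ?T) (row a) (row b) (col k A) (col l B)
        \<in> flattening_minors ?ns ?T"
      by (rule flattening_minorsI[OF _ _ row[OF k(3)] row[OF k(4)] row_neq
            col[OF AB(1,3) k(1)] col[OF AB(2,4) k(2)] col_neq])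
        (use r in \<open>auto simp: len\<close>)
    then have "minor2 (flattening ?ns {0} ?T) (row a) (row b) (col k A) (col l B) \<in> I"
      using sub by blast
    then show ?thesis
      unfolding minor2_def tensor[OF AB(1,3) k(1)] tensor[OF AB(2,4) k(2)] by (simp add: mult_ac)
  qed (use ideal_coord_ring_closed(1)[OF I] in \<open>simp_all add: mult.commute\<close>)
qed

lemma tensor_indices_snocE:
  assumes "J \<in> tensor_indices (ns @ [q])"
  obtains xs y where "J = xs @ [y]" "xs \<in> tensor_indices ns" "y < q"
proof -
  have len: "length J = Suc (length ns)" and nth: "\<And>i. i < Suc (length ns) \<Longrightarrow> J ! i < (ns @ [q]) ! i"
    using assms by (simp_all add: tensor_indices_def)
  then obtain xs y where J: "J = xs @ [y]" and xs: "length xs = length ns"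
    by (metis length_Suc_conv_rev)
  have "xs ! i < ns ! i" if "i < length ns" for i
    using nth[of i] that by (simp add: J xs nth_append)
  moreover have "y < q"
    using nth[of "length ns"] xs by (simp add: J nth_append)
  ultimately show thesis
    using that J xs by (simp add: tensor_indices_def)
qed

text \<open>The combined tensor of a point of the neuromanifold is an outer product of vectors:
  \<open>v\<close> in every position but the last, which carries the Kronecker product of
  \<open>c\<close> and \<open>v\<close>.\<close>

lemma coord_eval_combine_factors:
  "\<exists>u. \<forall>J\<in>tensor_indices (combined_format n r m).
     coord_eval (power_tuple n r m z) (combine n (tensor_entry n r) J)
       = (\<Prod>i<length (combined_format n r m). u i (J ! i))"
proof (cases r)
  case 0
  \<comment> \<open>The dummy format for \<open>r = 0\<close> has index lists of length one, and no
    empty list has their monomial. The normalizing factor is \<open>1 / 0\<close>, which is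
    0.\<close>
  have "tensor_entry n 0 k [j] = 0" for k j
  proof -
    have empty: "{J' \<in> tensor_indices (replicate 0 n). index_monomial J' = index_monomial [j]} = {}"
      by (auto simp: index_monomial_eq_iff tensor_indices_def)
    show ?thesis
      unfolding tensor_entry_def empty by (simp add: Const_0)
  qed
  then have "combine n (tensor_entry n 0) J = 0" if "J \<in> tensor_indices [n * m]" for J
    using that by (auto simp: tensor_indices_def length_Suc_conv combine_def)
  then show ?thesis
    by (intro exI[of _ "\<lambda>_ _. 0"]) (auto simp: 0 combined_format_def coord_eval_simps)
next
  case (Suc s)
  let ?u = "\<lambda>i x. if i = s then fst z (x div n) * snd z (x mod n) else snd z x"
  have "coord_eval (power_tuple n r m z) (combine n (tensor_entry n r) J) = (\<Prod>i<r. ?u i (J ! i))"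
    if "J \<in> tensor_indices (combined_format n r m)" for J
  proof -
    obtain xs y where J: "J = xs @ [y]" and xs: "xs \<in> tensor_indices (replicate s n)" and y: "y < n * m"
      using \<open>J \<in> _\<close> unfolding combined_format_def Suc diff_Suc_1 by (rule tensor_indices_snocE)
    have len: "length xs = s"
      using xs by (simp add: tensor_indices_replicate)
    have "n > 0" "y div n < m"
      using y by (auto simp: less_mult_imp_div_less mult.commute intro: Nat.gr0I)
    have "xs @ [y mod n] \<in> tensor_indices (replicate r n)"
      using xs \<open>n > 0\<close> unfolding tensor_indices_replicate by (auto simp: Suc)
    then have "(y div n, mset (xs @ [y mod n])) \<in> cells n r m"
      using \<open>y div n < m\<close> tensor_indices_iff_cells by blast
    then have "coord_eval (power_tuple n r m z) (combine n (tensor_entry n r) J)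
        = fst z (y div n) * (\<Prod>j\<in>#mset (xs @ [y mod n]). snd z j)"
      unfolding J combine_def tensor_entry_eq_entry using coord_eval_power_tuple_entry by simp
    also have "\<dots> = (\<Prod>j\<leftarrow>xs. snd z j) * (fst z (y div n) * snd z (y mod n))"
      by (simp add: mult_ac flip: prod_mset_prod_list)
    also have "(\<Prod>j\<leftarrow>xs. snd z j) = (\<Prod>i<s. ?u i (J ! i))"
      unfolding prod.list_conv_set_nth by (rule prod.cong) (auto simp: len J nth_append)
    also have "\<dots> * (fst z (y div n) * snd z (y mod n)) = (\<Prod>i<r. ?u i (J ! i))"
      by (simp add: Suc J nth_append len)
    finally show ?thesis .
  qed
  then show ?thesis
    by (intro exI[of _ ?u]) (simp add: combined_format_def Suc)
qed

text \<open>Every flattening of an outer product is a function of the row times a function of the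
  column, so its 2x2 minors vanish.\<close>

lemma flattening_minors_subset_vanishing_ideal:
  "flattening_minors (combined_format n r m) (combine n (tensor_entry n r))
     \<subseteq> vanishing_ideal n r m (neuromanifold [n, 1, m] r)"
proof
  fix p assume p: "p \<in> flattening_minors (combined_format n r m) (combine n (tensor_entry n r))"
  let ?ns = "combined_format n r m"
  have "coord_eval (power_tuple n r m z) p = 0" for z
  proof -
    obtain I1 I2 a a' b b' where
      p_eq: "p = minor2 (flattening ?ns I1 (combine n (tensor_entry n r))) a a' b b'"
      and I: "I1 \<union> I2 = {..<length ?ns}" "I1 \<inter> I2 = {}"
      and ab: "a \<in> (\<Pi>\<^sub>E i\<in>I1. {..<?ns ! i})" "a' \<in> (\<Pi>\<^sub>E i\<in>I1. {..<?ns ! i})"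
        "b \<in> (\<Pi>\<^sub>E i\<in>I2. {..<?ns ! i})" "b' \<in> (\<Pi>\<^sub>E i\<in>I2. {..<?ns ! i})"
      using p by (rule flattening_minorsE)
    obtain u where u: "\<And>J. J \<in> tensor_indices ?ns \<Longrightarrow>
        coord_eval (power_tuple n r m z) (combine n (tensor_entry n r) J)
          = (\<Prod>i<length ?ns. u i (J ! i))"
      using coord_eval_combine_factors[of n r m z] by blast
    have fin: "finite I1" "finite I2"
      using I(1) finite_Un finite_lessThan by metis+
    have "coord_eval (power_tuple n r m z) (flattening ?ns I1 (combine n (tensor_entry n r)) x y)
        = (\<Prod>i\<in>I1. u i (x i)) * (\<Prod>i\<in>I2. u i (y i))"
      if x: "x \<in> (\<Pi>\<^sub>E i\<in>I1. {..<?ns ! i})" and y: "y \<in> (\<Pi>\<^sub>E i\<in>I2. {..<?ns ! i})" for x y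
    proof -
      have "coord_eval (power_tuple n r m z) (flattening ?ns I1 (combine n (tensor_entry n r)) x y)
          = (\<Prod>i<length ?ns. u i (if i \<in> I1 then x i else y i))"
        unfolding flattening_def u[OF flattening_in_range[OF I(1) x y]] by (rule prod.cong) auto
      also have "\<dots> = (\<Prod>i\<in>I1. u i (if i \<in> I1 then x i else y i))
          * (\<Prod>i\<in>I2. u i (if i \<in> I1 then x i else y i))"
        unfolding I(1)[symmetric] by (rule prod.union_disjoint[OF fin I(2)])
      also have "(\<Prod>i\<in>I2. u i (if i \<in> I1 then x i else y i)) = (\<Prod>i\<in>I2. u i (y i))"
        using I(2) by (intro prod.cong) auto
      finally show ?thesis by simp
    qed
    then show ?thesis
      unfolding p_eq minor2_def coord_eval_simps by (simp add: ab)
  qed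
  moreover have "p \<in> carrier (coord_ring n r m)"
    using flattening_minors_combined_subset p by blast
  ultimately show "p \<in> vanishing_ideal n r m (neuromanifold [n, 1, m] r)"
    unfolding vanishing_ideal_def neuromanifold_eq_range by auto
qed

text \<open>The ideal generated by the minors is closed under exchanges and so contains the
  vanishing ideal; conversely, the vanishing ideal is an ideal containing the minors.\<close>

lemma vanishing_ideal_neuromanifold:
  assumes "r = 1 \<longrightarrow> n = 1 \<or> m = 1"
  shows "vanishing_ideal n r m (neuromanifold [n, 1, m] r) =
    Idl\<^bsub>coord_ring n r m\<^esub>
      (flattening_minors (combined_format n r m) (combine n (tensor_entry n r)))"
    (is "_ = Idl\<^bsub>_\<^esub> ?S")
proof
  interpret cring "coord_ring n r m" by (rule cring_coord_ring)
  have "ideal (Idl\<^bsub>coord_ring n r m\<^esub> ?S) (coord_ring n r m)"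
    "?S \<subseteq> Idl\<^bsub>coord_ring n r m\<^esub> ?S"
    using flattening_minors_combined_subset[of n r m] by (auto intro: genideal_ideal dest: genideal_self)
  then show "vanishing_ideal n r m (neuromanifold [n, 1, m] r) \<subseteq> Idl\<^bsub>coord_ring n r m\<^esub> ?S"
    by (intro vanishing_ideal_subset_exchange_closed exchange_closed_flattening_minors assms)
  show "Idl\<^bsub>coord_ring n r m\<^esub> ?S \<subseteq> vanishing_ideal n r m (neuromanifold [n, 1, m] r)"
    by (rule genideal_minimal[OF ideal_vanishing_ideal flattening_minors_subset_vanishing_ideal])
qed

text \<open>The premise of the last conjunct concerns \<open>r = 1\<close>. There the neuromanifold
  consists of the matrices of rank at most one, whose ideal is nonzero if \<open>d0\<close> and
  \<open>d2\<close> are at least 2, whereas a format with a single position has no 2x2 minors and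
  generates the zero ideal.\<close>

theorem lemma3p6:
  fixes d0 d2 r :: nat
  assumes "d0 > 0" and "d2 > 0"
  shows "neuromanifold [d0, 1, d2] r =
      {vec d2 (\<lambda>k. tensor_poly d0 r (T k)) | T.
         (\<forall>k<d2. T k \<in> sym_tensors d0 r \<and> sym_rank d0 r (T k) \<le> 1) \<and>
         (\<forall>k<d2. \<forall>l<d2. sym_rank d0 r (T k) = 1 \<and> sym_rank d0 r (T l) = 1 \<longrightarrow>
            (\<exists>c. \<forall>J\<in>tensor_indices (replicate r d0). T l J = c * T k J))}
    \<and> neuromanifold [d0, 1, d2] r = neurovariety [d0, 1, d2] r
    \<and> ((r = 1 \<longrightarrow> d0 = 1 \<or> d2 = 1) \<longrightarrow>
        vanishing_ideal d0 r d2 (neurovariety [d0, 1, d2] r) =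
          Idl\<^bsub>coord_ring d0 r d2\<^esub>
            (flattening_minors (combined_format d0 r d2) (combine d0 (tensor_entry d0 r))))"
  unfolding neurovariety_eq_neuromanifold[OF assms(1)]
  by (rule conjI[OF neuromanifold_eq_rank_one_tuples
        conjI[OF refl impI[OF vanishing_ideal_neuromanifold]]])

end
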